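(* Let $f:\mathbb R^{n_x}\times\mathbb R^{n_u}\to\mathbb R^{n_x}$ be three times continuously differentiable. Let $u=(u_0,\dots,u_{N-1})$ be a control sequence, $y\in\mathbb R^{n_x}$ an initial state and $\Sigma_0\in\mathbb S_+^{n_x}$ an initial variance (such that $E$ is well defined there, see context). Define $\sigma=[\sigma_0^{\mathsf T},\dots,\sigma_{N-1}^{\mathsf T}]^{\mathsf T}$ by the following algorithm, where $k$ ranges over $\{0,\dots,N-1\}$ and $\mathcal F,\mathcal G,\mathcal L,\mathcal M$ are the functions defined in the context: 1. (Nominal forward sweep) $\kappa_0=[y,\mathrm{vec}(\Sigma_0)]$, and forwards $\kappa_{k+1}=\mathcal F(\kappa_k,u_k)$. 2. (Nominal backward sweep) $\omega_N=\mathcal M(\kappa_N)$, and backwards $\omega_k=\mathcal G(\kappa_k,\omega_{k+1},u_k)$. 3. (Adjoint forward sweep) $a_0=0$, and forwards $a_{k+1}=\nabla_\omega\mathcal G(\kappa_k,\omega_{k+1},u_k)\,a_k-\nabla_\omega\mathcal L(\kappa_k,\omega_{k+1},u_k)$. 4. (Adjoint backward sweep) $b_N=\nabla\mathcal M(\kappa_N)\,a_N$, and backwards $b_k=\nabla_\kappa\mathcal G(\kappa_k,\omega_{k+1},u_k)\,a_k+\nabla_\kappa\mathcal F(\kappa_k,u_k)\,b_{k+1}-\nabla_\kappa\mathcal L(\kappa_k,\omega_{k+1},u_k)$. 5. (Final evaluation) $\sigma_k=\nabla_u\mathcal L(\kappa_k,\omega_{k+1},u_k)-\nabla_u\mathcal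 G(\kappa_k,\omega_{k+1},u_k)\,a_k-\nabla_u\mathcal F(\kappa_k,u_k)\,b_{k+1}$. Then $\sigma=\nabla_u E(u,y,\Sigma_0)$.
   Context: Notation: $\mathbb S_+^n$ (resp. $\mathbb S_{++}^n$) is the set of symmetric positive semi-definite (resp. positive definite) $n\times n$ matrices. $N\in\mathbb N$ is the horizon; $u_k\in\mathbb R^{n_u}$, $x_k\in\mathbb R^{n_x}$. For a vector-valued function $g$, $\nabla_z g$ denotes the transpose of the Jacobian $\partial g/\partial z$; for scalar functions it is the gradient column vector. $\nabla^2_{ux}h$ is the $n_u\times n_x$ matrix of mixed second derivatives, similarly $\nabla^2_{uu},\nabla^2_{xx}$. $\mathrm{vec}$ stacks all independent components of its argument into a vector (exploiting symmetry of symmetric matrices). Data: $f(0,0)=0$; control bounds $\underline u<0<\overline u$ in $\mathbb R^{n_u}$; $Q,P_N\in\mathbb S_+^{n_x}$, $R\in\mathbb S_+^{n_u}$; $\tau>0$; $C\in\mathbb R^{n_\eta\times n_x}$; $W\in\mathbb S_+^{n_x}$; $V\in\mathbb S_{++}^{n_\eta}$. Put $l(x,u)=\frac12(x^{\mathsf T}Qx+u^{\mathsf T}Ru)$ and $l_\tau(x,u)=l(x,u)-\tau\sum_{i=1}^{n_u}\log[(u_i-\underline u_i)(\overline u_i-u_i)]$ (for $\underline u<u<\overline u$). Let $A(x,u)=\partial f/\partial x(x,u)$, $B(x,u)=\partial f/\partial u(x,u)$, and $$F(x,u,\Sigma)=A(x,u)\left[\Sigma-\Sigma C^{\mathsf T}(C\Sigma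 C^{\mathsf T}+V)^{-1}C\Sigma\right]A(x,u)^{\mathsf T}+W.$$ For $\Omega=[\lambda,P]$ with $\lambda\in\mathbb R^{n_x}$ and $P$ a symmetric $n_x\times n_x$ matrix, let $$X(x,u,\Omega)=B^{\mathsf T}PA+\nabla^2_{ux}[l_\tau+\lambda^{\mathsf T}f],\quad Y(x,u,\Omega)=B^{\mathsf T}PB+\nabla^2_{uu}[l_\tau+\lambda^{\mathsf T}f],\quad Z(x,u,\Omega)=A^{\mathsf T}PA+\nabla^2_{xx}[l_\tau+\lambda^{\mathsf T}f],$$ all evaluated at $(x,u)$, and, where $Y$ is invertible, $\Phi=X^{\mathsf T}Y^{-1}X$, $$G(x,u,\Omega)=\left[A(x,u)^{\mathsf T}\lambda+Qx,\; Z(x,u,\Omega)-\Phi(x,u,\Omega)\right],\qquad M(x)=[P_Nx,\;P_N].$$ Function $E$: for given $u,x_0,\Sigma_0$, $$E(u,x_0,\Sigma_0)=\sum_{k=0}^{N-1}\tfrac12\mathrm{Tr}\left(\Phi(x_k,u_k,\Omega_{k+1})\Sigma_k\right),$$ where $x,\Sigma,\Omega$ are determined by $x_{k+1}=f(x_k,u_k)$, $\Sigma_{k+1}=F(x_k,u_k,\Sigma_k)$, $\Omega_N=M(x_N)$, $\Omega_k=G(x_k,u_k,\Omega_{k+1})$ for $k\in\{0,\dots,N-1\}$ (formally $E$ is the minimum over $x,\Sigma,\Omega$ subject to these equations, with $x_0,\Sigma_0$ given). $E$ is considered at points where it is well defined, i.e. $\underline u<u_k<\overline u$ and $Y(x_k,u_k,\Omega_{k+1})$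 is invertible for all $k$ along these recursions. Stacked functions: $\kappa_k=[x_k,\mathrm{vec}(\Sigma_k)]$, $\omega_k=\mathrm{vec}(\Omega_k)$, $\mathcal F(\kappa_k,u_k)=[f(x_k,u_k),\mathrm{vec}(F(x_k,u_k,\Sigma_k))]$, $\mathcal G(\kappa_k,\omega_{k+1},u_k)=\mathrm{vec}(G(x_k,u_k,\Omega_{k+1}))$, $\mathcal L(\kappa_k,\omega_{k+1},u_k)=\frac12\mathrm{Tr}(\Phi(x_k,u_k,\Omega_{k+1})\Sigma_k)$, $\mathcal M(\kappa_N)=\mathrm{vec}(M(x_N))$. In $\nabla_\omega\mathcal G$, $\nabla_\omega\mathcal L$ the derivative is with respect to the argument $\omega_{k+1}$. *)

theory Defs
  imports "HOL-Analysis.Analysis" "HOL-Library.Uprod"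
begin

section \<open>Matrices and derivatives\<close>

definition psd :: "real^'n^'n \<Rightarrow> bool" where
  "psd S \<longleftrightarrow> transpose S = S \<and> (\<forall>x. 0 \<le> x \<bullet> (S *v x))"

definition posdef :: "real^'n^'n \<Rightarrow> bool" where
  "posdef S \<longleftrightarrow> transpose S = S \<and> (\<forall>x. x \<noteq> 0 \<longrightarrow> 0 < x \<bullet> (S *v x))"

definition grad :: "('a::euclidean_space \<Rightarrow> real) \<Rightarrow> 'a \<Rightarrow> 'a" where
  "grad h z = (THE D. GDERIV h z :> D)"

text \<open>For vector-valued \<open>g\<close>, the gradient is the transpose of the Jacobian, here as a linear map.\<close>

definition nabla :: "('a::euclidean_space \<Rightarrow> 'b::euclidean_space) \<Rightarrow> 'a \<Rightarrow> 'b \<Rightarrow> 'a" where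
  "nabla g z = adjoint (frechet_derivative g (at z))"

definition C3 :: "('a::real_normed_vector \<Rightarrow> 'b::real_normed_vector) \<Rightarrow> bool" where
  "C3 g \<longleftrightarrow> (\<exists>(g1 :: 'a \<Rightarrow> 'a \<Rightarrow>\<^sub>L 'b) (g2 :: 'a \<Rightarrow> 'a \<Rightarrow>\<^sub>L 'a \<Rightarrow>\<^sub>L 'b)
        (g3 :: 'a \<Rightarrow> 'a \<Rightarrow>\<^sub>L 'a \<Rightarrow>\<^sub>L 'a \<Rightarrow>\<^sub>L 'b).
      (\<forall>z. (g has_derivative blinfun_apply (g1 z)) (at z)) \<and>
      (\<forall>z. (g1 has_derivative blinfun_apply (g2 z)) (at z)) \<and>
      (\<forall>z. (g2 has_derivative blinfun_apply (g3 z)) (at z)) \<and>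
      continuous_on UNIV g3)"


section \<open>Vectorization of symmetric matrices\<close>

text \<open>
  The independent components of a symmetric matrix are indexed by unordered pairs of indices,
  so there are \<open>n (n + 1) / 2\<close> of them. On matrices that are not symmetric, the component of
  \<open>vech\<close> at an unordered pair is one of the two mirror entries, chosen independently of the matrix.
\<close>

instance uprod :: (finite) finite
proof
  have "UNIV = (\<lambda>(i, j). Upair i j) ` (UNIV :: ('a \<times> 'a) set)"
    by (auto simp: image_iff) (metis uprod_exhaust)
  then show "finite (UNIV :: 'a uprod set)"
    by (metis finite_imageI finite)
qed

definition vech :: "real^'n^'n \<Rightarrow> real^('n uprod)" where
  "vech S = (\<chi> p. let ij = (SOME ij. Upair (fst ij) (snd ij) = p) in S $ fst ij $ snd ij)"

definition unvech :: "real^('n uprod) \<Rightarrow> real^'n^'n" where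
  "unvech v = (\<chi> i j. v $ Upair i j)"

lemma Upair_some: "Upair (fst (SOME ij. Upair (fst ij) (snd ij) = p))
    (snd (SOME ij. Upair (fst ij) (snd ij) = p)) = p"
proof -
  obtain i j where "p = Upair i j" by (cases p)
  then have "\<exists>ij. Upair (fst ij) (snd ij) = p" by auto
  then show ?thesis by (rule someI_ex)
qed

lemma vech_unvech: "vech (unvech v) = v"
  by (simp add: vech_def unvech_def Let_def Upair_some)

lemma unvech_vech:
  assumes "transpose S = S"
  shows "unvech (vech S) = S"
proof -
  have sym: "S $ i $ j = S $ j $ i" for i j
    using arg_cong[OF assms, of "\<lambda>T. T $ i $ j"] by (simp add: transpose_def)
  have "vech S $ Upair i j = S $ i $ j" for i j
    using Upair_some[of "Upair i j"] sym[of i j] by (auto simp: vech_def Let_def)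
  then show ?thesis by (simp add: unvech_def vec_eq_iff)
qed


section \<open>Problem data\<close>

record ('n::finite, 'm::finite, 'e::finite) ocp =
  dyn :: "real^'n \<Rightarrow> real^'m \<Rightarrow> real^'n"
  u_lo :: "real^'m"
  u_hi :: "real^'m"
  Qmat :: "real^'n^'n"
  Rmat :: "real^'m^'m"
  PNmat :: "real^'n^'n"
  barrier :: real
  Cmat :: "real^'n^'e"
  Wmat :: "real^'n^'n"
  Vmat :: "real^'e^'e"

definition admissible :: "('n::finite, 'm::finite, 'e::finite) ocp \<Rightarrow> real^'m \<Rightarrow> bool" where
  "admissible D u \<longleftrightarrow> (\<forall>i. u_lo D $ i < u $ i \<and> u $ i < u_hi D $ i)"

definition stage_cost :: "('n::finite, 'm::finite, 'e::finite) ocp \<Rightarrow> real^'n \<Rightarrow> real^'m \<Rightarrow> real" where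
  "stage_cost D x u = (x \<bullet> (Qmat D *v x) + u \<bullet> (Rmat D *v u)) / 2"

text \<open>Only meaningful for admissible \<open>u\<close>, where the argument of the logarithm is positive.\<close>

definition barrier_cost :: "('n::finite, 'm::finite, 'e::finite) ocp \<Rightarrow> real^'n \<Rightarrow> real^'m \<Rightarrow> real" where
  "barrier_cost D x u = stage_cost D x u
     - barrier D * (\<Sum>i\<in>UNIV. ln ((u $ i - u_lo D $ i) * (u_hi D $ i - u $ i)))"

definition Amat :: "('n::finite, 'm::finite, 'e::finite) ocp \<Rightarrow> real^'n \<Rightarrow> real^'m \<Rightarrow> real^'n^'n" where
  "Amat D x u = jacobian (\<lambda>x'. dyn D x' u) (at x)"

definition Bmat :: "('n::finite, 'm::finite, 'e::finite) ocp \<Rightarrow> real^'n \<Rightarrow> real^'m \<Rightarrow> real^'m^'n" where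
  "Bmat D x u = jacobian (\<lambda>u'. dyn D x u') (at u)"

definition Fmap :: "('n::finite, 'm::finite, 'e::finite) ocp \<Rightarrow>
    real^'n \<Rightarrow> real^'m \<Rightarrow> real^'n^'n \<Rightarrow> real^'n^'n" where
  "Fmap D x u S =
     Amat D x u **
       (S - S ** transpose (Cmat D) **
              matrix_inv (Cmat D ** S ** transpose (Cmat D) + Vmat D) ** Cmat D ** S) **
       transpose (Amat D x u)
     + Wmat D"


section \<open>Second-order quantities\<close>

text \<open>The entry in row \<open>i\<close> and column \<open>j\<close> of \<open>hess_ux h x u\<close> is
  \<open>\<partial>\<^sup>2h / \<partial>u\<^sub>i\<partial>x\<^sub>j\<close>.\<close>

definition hess_ux :: "(real^'n \<Rightarrow> real^'m \<Rightarrow> real) \<Rightarrow> real^'n \<Rightarrow> real^'m \<Rightarrow> real^'n^'m" where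
  "hess_ux h x u = jacobian (\<lambda>x'. grad (\<lambda>u'. h x' u') u) (at x)"

definition hess_uu :: "(real^'n \<Rightarrow> real^'m \<Rightarrow> real) \<Rightarrow> real^'n \<Rightarrow> real^'m \<Rightarrow> real^'m^'m" where
  "hess_uu h x u = jacobian (grad (\<lambda>u'. h x u')) (at u)"

definition hess_xx :: "(real^'n \<Rightarrow> real^'m \<Rightarrow> real) \<Rightarrow> real^'n \<Rightarrow> real^'m \<Rightarrow> real^'n^'n" where
  "hess_xx h x u = jacobian (grad (\<lambda>x'. h x' u)) (at x)"

definition hamiltonian :: "('n::finite, 'm::finite, 'e::finite) ocp \<Rightarrow>
    real^'n \<Rightarrow> real^'n \<Rightarrow> real^'m \<Rightarrow> real" where
  "hamiltonian D lam x u = barrier_cost D x u + lam \<bullet> dyn D x u"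

definition Xmat :: "('n::finite, 'm::finite, 'e::finite) ocp \<Rightarrow>
    real^'n \<Rightarrow> real^'m \<Rightarrow> (real^'n) \<times> (real^'n^'n) \<Rightarrow> real^'n^'m" where
  "Xmat D x u Om = (case Om of (lam, P) \<Rightarrow>
     transpose (Bmat D x u) ** P ** Amat D x u + hess_ux (hamiltonian D lam) x u)"

definition Ymat :: "('n::finite, 'm::finite, 'e::finite) ocp \<Rightarrow>
    real^'n \<Rightarrow> real^'m \<Rightarrow> (real^'n) \<times> (real^'n^'n) \<Rightarrow> real^'m^'m" where
  "Ymat D x u Om = (case Om of (lam, P) \<Rightarrow>
     transpose (Bmat D x u) ** P ** Bmat D x u + hess_uu (hamiltonian D lam) x u)"

definition Zmat :: "('n::finite, 'm::finite, 'e::finite) ocp \<Rightarrow>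
    real^'n \<Rightarrow> real^'m \<Rightarrow> (real^'n) \<times> (real^'n^'n) \<Rightarrow> real^'n^'n" where
  "Zmat D x u Om = (case Om of (lam, P) \<Rightarrow>
     transpose (Amat D x u) ** P ** Amat D x u + hess_xx (hamiltonian D lam) x u)"

definition Phi :: "('n::finite, 'm::finite, 'e::finite) ocp \<Rightarrow>
    real^'n \<Rightarrow> real^'m \<Rightarrow> (real^'n) \<times> (real^'n^'n) \<Rightarrow> real^'n^'n" where
  "Phi D x u Om = transpose (Xmat D x u Om) ** matrix_inv (Ymat D x u Om) ** Xmat D x u Om"

definition Gmap :: "('n::finite, 'm::finite, 'e::finite) ocp \<Rightarrow>
    real^'n \<Rightarrow> real^'m \<Rightarrow> (real^'n) \<times> (real^'n^'n) \<Rightarrow> (real^'n) \<times> (real^'n^'n)" where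
  "Gmap D x u Om =
     (transpose (Amat D x u) *v fst Om + Qmat D *v x, Zmat D x u Om - Phi D x u Om)"

definition Mmap :: "('n::finite, 'm::finite, 'e::finite) ocp \<Rightarrow>
    real^'n \<Rightarrow> (real^'n) \<times> (real^'n^'n)" where
  "Mmap D x = (PNmat D *v x, PNmat D)"


section \<open>The function E\<close>

primrec state :: "('n::finite, 'm::finite, 'e::finite) ocp \<Rightarrow>
    (nat \<Rightarrow> real^'m) \<Rightarrow> real^'n \<Rightarrow> nat \<Rightarrow> real^'n" where
  "state D u x0 0 = x0"
| "state D u x0 (Suc k) = dyn D (state D u x0 k) (u k)"

primrec variance :: "('n::finite, 'm::finite, 'e::finite) ocp \<Rightarrow>
    (nat \<Rightarrow> real^'m) \<Rightarrow> real^'n \<Rightarrow> real^'n^'n \<Rightarrow> nat \<Rightarrow> real^'n^'n" where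
  "variance D u x0 S0 0 = S0"
| "variance D u x0 S0 (Suc k) = Fmap D (state D u x0 k) (u k) (variance D u x0 S0 k)"

text \<open>\<open>costate_rev D N u x0 j\<close> is \<open>\<Omega>\<close> at stage \<open>N - j\<close>.\<close>

primrec costate_rev :: "('n::finite, 'm::finite, 'e::finite) ocp \<Rightarrow>
    nat \<Rightarrow> (nat \<Rightarrow> real^'m) \<Rightarrow> real^'n \<Rightarrow> nat \<Rightarrow> (real^'n) \<times> (real^'n^'n)" where
  "costate_rev D N u x0 0 = Mmap D (state D u x0 N)"
| "costate_rev D N u x0 (Suc j) =
     Gmap D (state D u x0 (N - Suc j)) (u (N - Suc j)) (costate_rev D N u x0 j)"

definition costate :: "('n::finite, 'm::finite, 'e::finite) ocp \<Rightarrow>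
    nat \<Rightarrow> (nat \<Rightarrow> real^'m) \<Rightarrow> real^'n \<Rightarrow> nat \<Rightarrow> (real^'n) \<times> (real^'n^'n)" where
  "costate D N u x0 k = costate_rev D N u x0 (N - k)"

lemma costate_N: "costate D N u x0 N = Mmap D (state D u x0 N)"
  by (simp add: costate_def)

lemma costate_step:
  assumes "k < N"
  shows "costate D N u x0 k = Gmap D (state D u x0 k) (u k) (costate D N u x0 (Suc k))"
proof -
  have "N - k = Suc (N - Suc k)" "N - Suc (N - Suc k) = k" using assms by auto
  then show ?thesis by (simp add: costate_def)
qed

definition Efun :: "('n::finite, 'm::finite, 'e::finite) ocp \<Rightarrow>
    nat \<Rightarrow> (nat \<Rightarrow> real^'m) \<Rightarrow> real^'n \<Rightarrow> real^'n^'n \<Rightarrow> real" where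
  "Efun D N u x0 S0 =
     (\<Sum>k<N. trace (Phi D (state D u x0 k) (u k) (costate D N u x0 (Suc k))
                     ** variance D u x0 S0 k) / 2)"

definition E_well_defined :: "('n::finite, 'm::finite, 'e::finite) ocp \<Rightarrow>
    nat \<Rightarrow> (nat \<Rightarrow> real^'m) \<Rightarrow> real^'n \<Rightarrow> bool" where
  "E_well_defined D N u x0 \<longleftrightarrow>
     (\<forall>k<N. admissible D (u k) \<and>
        invertible (Ymat D (state D u x0 k) (u k) (costate D N u x0 (Suc k))))"


section \<open>Stacked functions\<close>

text \<open>Both \<open>\<kappa> = [x, vec \<Sigma>]\<close> and \<open>\<omega> = [\<lambda>, vec P]\<close> live in the Euclidean space
  \<open>(real^'n) \<times> (real^('n uprod))\<close>.\<close>

type_synonym 'n stacked = "(real^'n) \<times> (real^('n uprod))"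

definition vecOm :: "(real^'n) \<times> (real^'n^'n) \<Rightarrow> 'n::finite stacked" where
  "vecOm Om = (fst Om, vech (snd Om))"

definition unvecOm :: "'n::finite stacked \<Rightarrow> (real^'n) \<times> (real^'n^'n)" where
  "unvecOm w = (fst w, unvech (snd w))"

definition Fst :: "('n::finite, 'm::finite, 'e::finite) ocp \<Rightarrow>
    'n stacked \<Rightarrow> real^'m \<Rightarrow> 'n stacked" where
  "Fst D kap u = (dyn D (fst kap) u, vech (Fmap D (fst kap) u (unvech (snd kap))))"

definition Gst :: "('n::finite, 'm::finite, 'e::finite) ocp \<Rightarrow>
    'n stacked \<Rightarrow> 'n stacked \<Rightarrow> real^'m \<Rightarrow> 'n stacked" where
  "Gst D kap om u = vecOm (Gmap D (fst kap) u (unvecOm om))"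

definition Lst :: "('n::finite, 'm::finite, 'e::finite) ocp \<Rightarrow>
    'n stacked \<Rightarrow> 'n stacked \<Rightarrow> real^'m \<Rightarrow> real" where
  "Lst D kap om u = trace (Phi D (fst kap) u (unvecOm om) ** unvech (snd kap)) / 2"

definition Mst :: "('n::finite, 'm::finite, 'e::finite) ocp \<Rightarrow> 'n stacked \<Rightarrow> 'n stacked" where
  "Mst D kap = vecOm (Mmap D (fst kap))"

end

theory Submission
  imports Defs
begin

text \<open>
  The function \<open>E\<close> is a sum of stage costs that depend on two recursions: the state and its variance,
  collected in \<open>\<kappa>\<close>, run forwards in time, and the value function coefficients, collected in \<open>\<omega>\<close>,
  run backwards along the trajectory just computed. Differentiating along a perturbation of the
  controls linearizes both recursions. The adjoint variables \<open>a\<close> and \<open>b\<close> are Lagrange multipliers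
  for these recursions: pairing them with the linearized recursions makes every term cancel except
  the direct dependence on the controls, which is \<open>\<sigma>\<close>. This is a telescoping sum, proved for arbitrary
  differentiable stage functions in \<open>adjoint_sweep_gradient\<close>.

  What remains is to see that the recursions of the optimal control problem are an instance.

  \<^item> Differentiability. The stage functions are built by matrix algebra from the first and second
  derivatives of the dynamics, the Hessian of the logarithmic barrier, and two matrix inverses. Since
  the dynamics are three times differentiable and the controls are strictly inside their bounds, it is
  enough that the inverted matrices are invertible (\<open>differentiable_matrix_inv\<close>). For \<open>Y\<close> this is the
  assumption that \<open>E\<close> is well defined; for \<open>C \<Sigma> C\<^sup>T + V\<close> it follows from \<open>V\<close> being positive definite
  once \<open>\<Sigma>\<close> is known to be positive semidefinite, which the variance recursion preserves
  (\<open>psd_conditional_variance\<close>).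

  \<^item> Vectorization. The algorithm works with the independent components of \<open>\<Sigma>\<close> and \<open>P\<close>, while \<open>E\<close> is
  defined with the matrices themselves. Both descriptions agree as long as the matrices are symmetric.
  For \<open>\<Sigma>\<close> this holds for all controls. For \<open>P\<close> it needs the symmetry of second derivatives
  (\<open>symmetric_second_derivative\<close>) and the invertibility of \<open>Y\<close>, and so it holds for controls near the
  given ones (\<open>costate_regular_near\<close>); this suffices for computing a derivative.
\<close>

section \<open>Gradients and partial derivatives\<close>

lemma has_derivative_eventually_eq:
  assumes "(f has_derivative f') (at x)" "eventually (\<lambda>y. g y = f y) (nhds x)"
  shows "(g has_derivative f') (at x)"
proof -
  obtain S where "open S" "x \<in> S" "\<And>y. y \<in> S \<Longrightarrow> f y = g y"
    using assms(2) by (auto simp: eventually_nhds)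
  with assms(1) show ?thesis
    by (rule has_derivative_transform_within_open)
qed

lemma eventually_eq_differentiable:
  assumes "f differentiable (at x)" "eventually (\<lambda>y. g y = f y) (nhds x)"
  shows "g differentiable (at x)"
  using assms has_derivative_eventually_eq unfolding differentiable_def by blast

lemma GDERIV_grad:
  fixes h :: "'a::euclidean_space \<Rightarrow> real"
  assumes "GDERIV h z :> d"
  shows "grad h z = d"
  unfolding grad_def
proof (rule the_equality)
  fix d' assume "GDERIV h z :> d'"
  with assms have "(\<lambda>v. v \<bullet> d') = (\<lambda>v. v \<bullet> d)"
    unfolding gderiv_def by (rule has_derivative_unique[rotated])
  then show "d' = d"
    by (metis inner_commute vector_eq_ldot)
qed fact

lemma inner_grad:
  fixes h :: "'a::euclidean_space \<Rightarrow> real"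
  assumes "(h has_derivative h') (at z)"
  shows "v \<bullet> grad h z = h' v"
proof -
  have lin: "linear h'" using assms has_derivative_linear by blast
  have eq: "w \<bullet> adjoint h' 1 = h' w" for w
    by (simp add: adjoint_works[OF lin])
  then have "GDERIV h z :> adjoint h' 1"
    using assms by (simp add: gderiv_def)
  then show ?thesis using eq GDERIV_grad by metis
qed

text \<open>
  Every gradient and every transposed Jacobian in the algorithm is used only through this lemma and
  the previous one: paired with a direction \<open>v\<close>, they give back the derivative along \<open>v\<close>.
\<close>

lemma inner_nabla:
  fixes g :: "'a::euclidean_space \<Rightarrow> 'b::euclidean_space"
  assumes "(g has_derivative g') (at z)"
  shows "v \<bullet> nabla g z y = g' v \<bullet> y"
proof -
  have "linear g'" using assms has_derivative_linear by blast
  then show ?thesis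
    unfolding nabla_def frechet_derivative_at[OF assms, symmetric] by (rule adjoint_works)
qed

lemma partial_derivatives2:
  assumes "((\<lambda>(z, v). F z v) has_derivative F') (at (z, v))"
  shows "((\<lambda>z. F z v) has_derivative (\<lambda>h. F' (h, 0))) (at z)"
    and "((\<lambda>v. F z v) has_derivative (\<lambda>h. F' (0, h))) (at v)"
proof -
  have "((\<lambda>z. (z, v)) has_derivative (\<lambda>h. (h, 0))) (at z)"
    "((\<lambda>v. (z, v)) has_derivative (\<lambda>h. (0, h))) (at v)"
    by (auto intro!: derivative_eq_intros)
  from this[THEN has_derivative_compose, OF assms]
  show "((\<lambda>z. F z v) has_derivative (\<lambda>h. F' (h, 0))) (at z)"
    "((\<lambda>v. F z v) has_derivative (\<lambda>h. F' (0, h))) (at v)"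
    by simp_all
qed

lemma partial_derivatives3:
  assumes "((\<lambda>(z, w, v). G z w v) has_derivative G') (at (z, w, v))"
  shows "((\<lambda>z. G z w v) has_derivative (\<lambda>h. G' (h, 0, 0))) (at z)"
    and "((\<lambda>w. G z w v) has_derivative (\<lambda>h. G' (0, h, 0))) (at w)"
    and "((\<lambda>v. G z w v) has_derivative (\<lambda>h. G' (0, 0, h))) (at v)"
proof -
  have "((\<lambda>z. (z, w, v)) has_derivative (\<lambda>h. (h, 0, 0))) (at z)"
    "((\<lambda>w. (z, w, v)) has_derivative (\<lambda>h. (0, h, 0))) (at w)"
    "((\<lambda>v. (z, w, v)) has_derivative (\<lambda>h. (0, 0, h))) (at v)"
    by (auto intro!: derivative_eq_intros simp: zero_prod_def)
  from this[THEN has_derivative_compose, OF assms]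
  show "((\<lambda>z. G z w v) has_derivative (\<lambda>h. G' (h, 0, 0))) (at z)"
    "((\<lambda>w. G z w v) has_derivative (\<lambda>h. G' (0, h, 0))) (at w)"
    "((\<lambda>v. G z w v) has_derivative (\<lambda>h. G' (0, 0, h))) (at v)"
    by simp_all
qed

lemma linear_split3:
  assumes "linear (G' :: 'a::real_vector \<times> 'b::real_vector \<times> 'c::real_vector \<Rightarrow> 'd::real_vector)"
  shows "G' (p, q, r) = G' (p, 0, 0) + G' (0, q, 0) + G' (0, 0, r)"
proof -
  have "(p, q, r) = (p, 0, 0) + (0, q, 0) + (0, 0, r)" by simp
  then show ?thesis using linear_add[OF assms] by metis
qed

lemma linear_split2:
  assumes "linear (F' :: 'a::real_vector \<times> 'b::real_vector \<Rightarrow> 'd::real_vector)"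
  shows "F' (p, q) = F' (p, 0) + F' (0, q)"
proof -
  have "(p, q) = (p, 0) + (0, q)" by simp
  then show ?thesis using linear_add[OF assms] by metis
qed

section \<open>The gradient of a cost with forward and backward dynamics\<close>

text \<open>
  This is the heart of the matter; nothing in it depends on the particular dynamics. Let \<open>dk\<close> and
  \<open>dw\<close> be the derivatives of the forward variable \<open>kap\<close> and of the backward variable \<open>om\<close> along a
  perturbation \<open>h\<close> of the controls; they satisfy the linearized recursions. The adjoint recursions
  for \<open>a\<close> and \<open>b\<close> are designed so that the amount by which the stage derivative of the cost differs
  from \<open>h\<^sub>k \<bullet> \<sigma>\<^sub>k\<close> is the increment \<open>T (k + 1) - T k\<close> of \<open>T k = dk k \<bullet> b k - dw k \<bullet> a k\<close>. Hence the
  total difference is \<open>T N - T 0\<close>. Here \<open>T 0 = 0\<close> because \<open>kap\<close> starts at a fixed point and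
  \<open>a 0 = 0\<close>, and \<open>T N = 0\<close> because \<open>b N\<close> is the transposed derivative of \<open>M\<close> applied to \<open>a N\<close>.

  The adjoint sweeps run against the flow of information: \<open>om\<close> is computed backwards, so its
  multiplier \<open>a\<close> is computed forwards, and the opposite holds for \<open>kap\<close> and \<open>b\<close>.

  The recursions for \<open>kap\<close> and \<open>om\<close> are asked to hold only for controls near \<open>u\<close>, since in the
  application the backward recursion has its good properties only there.
\<close>

theorem adjoint_sweep_gradient:
  fixes F :: "'k::euclidean_space \<Rightarrow> 'v::euclidean_space \<Rightarrow> 'k"
    and G :: "'k \<Rightarrow> 'w::euclidean_space \<Rightarrow> 'v \<Rightarrow> 'w"
    and L :: "'k \<Rightarrow> 'w \<Rightarrow> 'v \<Rightarrow> real"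
    and M :: "'k \<Rightarrow> 'w"
    and u \<sigma> :: "'v^'h::finite"
    and kap :: "'v^'h \<Rightarrow> nat \<Rightarrow> 'k" and om :: "'v^'h \<Rightarrow> nat \<Rightarrow> 'w"
  assumes stage: "bij_betw stage {..<N} (UNIV :: 'h set)"
    and F: "\<And>k. k < N \<Longrightarrow> (\<lambda>(z, v). F z v) differentiable (at (kap u k, u $ stage k))"
    and G: "\<And>k. k < N \<Longrightarrow>
      (\<lambda>(z, w, v). G z w v) differentiable (at (kap u k, om u (Suc k), u $ stage k))"
    and L: "\<And>k. k < N \<Longrightarrow>
      (\<lambda>(z, w, v). L z w v) differentiable (at (kap u k, om u (Suc k), u $ stage k))"
    and M: "M differentiable (at (kap u N))"
    and kap_diff: "\<And>k. k \<le> N \<Longrightarrow> (\<lambda>u'. kap u' k) differentiable (at u)"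
    and om_diff: "\<And>k. k \<le> N \<Longrightarrow> (\<lambda>u'. om u' k) differentiable (at u)"
    and kap_0: "\<And>u'. kap u' 0 = start"
    and kap_step: "\<And>k. k < N \<Longrightarrow>
      eventually (\<lambda>u'. kap u' (Suc k) = F (kap u' k) (u' $ stage k)) (nhds u)"
    and om_N: "eventually (\<lambda>u'. om u' N = M (kap u' N)) (nhds u)"
    and om_step: "\<And>k. k < N \<Longrightarrow>
      eventually (\<lambda>u'. om u' k = G (kap u' k) (om u' (Suc k)) (u' $ stage k)) (nhds u)"
    and E: "eventually (\<lambda>u'. E u' = (\<Sum>k<N. L (kap u' k) (om u' (Suc k)) (u' $ stage k))) (nhds u)"
    and a_0: "a 0 = 0"
    and a_step: "\<And>k. k < N \<Longrightarrow>
      a (Suc k) = nabla (\<lambda>w. G (kap u k) w (u $ stage k)) (om u (Suc k)) (a k)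
                - grad (\<lambda>w. L (kap u k) w (u $ stage k)) (om u (Suc k))"
    and b_N: "b N = nabla M (kap u N) (a N)"
    and b_step: "\<And>k. k < N \<Longrightarrow>
      b k = nabla (\<lambda>z. G z (om u (Suc k)) (u $ stage k)) (kap u k) (a k)
          + nabla (\<lambda>z. F z (u $ stage k)) (kap u k) (b (Suc k))
          - grad (\<lambda>z. L z (om u (Suc k)) (u $ stage k)) (kap u k)"
    and sigma: "\<And>k. k < N \<Longrightarrow>
      \<sigma> $ stage k = grad (\<lambda>v. L (kap u k) (om u (Suc k)) v) (u $ stage k)
                  - nabla (\<lambda>v. G (kap u k) (om u (Suc k)) v) (u $ stage k) (a k)
                  - nabla (\<lambda>v. F (kap u k) v) (u $ stage k) (b (Suc k))"
  shows "GDERIV E u :> \<sigma>"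
proof -
  have "\<forall>k\<in>{..<N}. \<exists>d. ((\<lambda>(z, v). F z v) has_derivative d) (at (kap u k, u $ stage k))"
    using F by (auto simp: differentiable_def)
  then obtain F' where F': "\<And>k. k < N \<Longrightarrow>
      ((\<lambda>(z, v). F z v) has_derivative F' k) (at (kap u k, u $ stage k))"
    by (metis lessThan_iff)
  have "\<forall>k\<in>{..<N}. \<exists>d. ((\<lambda>(z, w, v). G z w v) has_derivative d) (at (kap u k, om u (Suc k), u $ stage k))"
    using G by (auto simp: differentiable_def)
  then obtain G' where G': "\<And>k. k < N \<Longrightarrow>
      ((\<lambda>(z, w, v). G z w v) has_derivative G' k) (at (kap u k, om u (Suc k), u $ stage k))"
    by (metis lessThan_iff)
  have "\<forall>k\<in>{..<N}. \<exists>d. ((\<lambda>(z, w, v). L z w v) has_derivative d) (at (kap u k, om u (Suc k), u $ stage k))"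
    using L by (auto simp: differentiable_def)
  then obtain L' where L': "\<And>k. k < N \<Longrightarrow>
      ((\<lambda>(z, w, v). L z w v) has_derivative L' k) (at (kap u k, om u (Suc k), u $ stage k))"
    by (metis lessThan_iff)
  obtain M' where M': "(M has_derivative M') (at (kap u N))"
    using M by (auto simp: differentiable_def)
  have "\<forall>k\<in>{..N}. \<exists>d. ((\<lambda>u'. kap u' k) has_derivative d) (at u)"
    using kap_diff by (auto simp: differentiable_def)
  then obtain dk where dk: "\<And>k. k \<le> N \<Longrightarrow> ((\<lambda>u'. kap u' k) has_derivative dk k) (at u)"
    by (metis atMost_iff)
  have "\<forall>k\<in>{..N}. \<exists>d. ((\<lambda>u'. om u' k) has_derivative d) (at u)"
    using om_diff by (auto simp: differentiable_def)
  then obtain dw where dw: "\<And>k. k \<le> N \<Longrightarrow> ((\<lambda>u'. om u' k) has_derivative dw k) (at u)"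
    by (metis atMost_iff)

  have du: "((\<lambda>u'. u' $ i) has_derivative (\<lambda>h. h $ i)) (at u)" for i
    by (intro bounded_linear_imp_has_derivative bounded_linear_vec_nth)
  have triple: "((\<lambda>u'. (kap u' k, om u' (Suc k), u' $ stage k)) has_derivative
      (\<lambda>h. (dk k h, dw (Suc k) h, h $ stage k))) (at u)" if "k < N" for k
    using that by (intro has_derivative_Pair dk dw du) auto
  have pair: "((\<lambda>u'. (kap u' k, u' $ stage k)) has_derivative (\<lambda>h. (dk k h, h $ stage k))) (at u)"
    if "k < N" for k
    using that by (intro has_derivative_Pair dk du) auto

  have dk_0: "dk 0 h = 0" for h
  proof -
    have "((\<lambda>u'. kap u' 0) has_derivative (\<lambda>h. 0)) (at u)" by (simp add: kap_0)
    from has_derivative_unique[OF dk[of 0] this] show ?thesis by simp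
  qed
  have dk_Suc: "dk (Suc k) h = F' k (dk k h, 0) + F' k (0, h $ stage k)" if k: "k < N" for k h
  proof -
    have "((\<lambda>u'. F (kap u' k) (u' $ stage k)) has_derivative (\<lambda>h. F' k (dk k h, h $ stage k))) (at u)"
      using has_derivative_compose[OF pair[OF k], of "\<lambda>(z, v). F z v" "F' k"] F'[OF k] by simp
    then have "((\<lambda>u'. kap u' (Suc k)) has_derivative (\<lambda>h. F' k (dk k h, h $ stage k))) (at u)"
      by (rule has_derivative_eventually_eq) (rule kap_step[OF k])
    then have "dk (Suc k) = (\<lambda>h. F' k (dk k h, h $ stage k))"
      using has_derivative_unique[OF dk[of "Suc k"]] k by simp
    then show ?thesis
      using linear_split2[OF has_derivative_linear[OF F'[OF k]], of "dk k h" "h $ stage k"] by simp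
  qed
  have dw_N: "dw N h = M' (dk N h)" for h
  proof -
    have "((\<lambda>u'. M (kap u' N)) has_derivative (\<lambda>h. M' (dk N h))) (at u)"
      using has_derivative_compose[OF dk[of N] M'] by simp
    then have "((\<lambda>u'. om u' N) has_derivative (\<lambda>h. M' (dk N h))) (at u)"
      by (rule has_derivative_eventually_eq) (rule om_N)
    from has_derivative_unique[OF dw[of N] this] show ?thesis by simp
  qed
  have dw_step: "dw k h = G' k (dk k h, 0, 0) + G' k (0, dw (Suc k) h, 0) + G' k (0, 0, h $ stage k)"
    if k: "k < N" for k h
  proof -
    have "((\<lambda>u'. G (kap u' k) (om u' (Suc k)) (u' $ stage k)) has_derivative
        (\<lambda>h. G' k (dk k h, dw (Suc k) h, h $ stage k))) (at u)"
      using has_derivative_compose[OF triple[OF k], of "\<lambda>(z, w, v). G z w v" "G' k"] G'[OF k]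
      by simp
    then have "((\<lambda>u'. om u' k) has_derivative
        (\<lambda>h. G' k (dk k h, dw (Suc k) h, h $ stage k))) (at u)"
      by (rule has_derivative_eventually_eq) (rule om_step[OF k])
    then have "dw k = (\<lambda>h. G' k (dk k h, dw (Suc k) h, h $ stage k))"
      using has_derivative_unique[OF dw[of k]] k by simp
    then show ?thesis
      using linear_split3[OF has_derivative_linear[OF G'[OF k]], of "dk k h" "dw (Suc k) h" "h $ stage k"]
      by simp
  qed

  have dL: "((\<lambda>u'. L (kap u' k) (om u' (Suc k)) (u' $ stage k)) has_derivative
      (\<lambda>h. L' k (dk k h, dw (Suc k) h, h $ stage k))) (at u)" if k: "k < N" for k
    using has_derivative_compose[OF triple[OF k], of "\<lambda>(z, w, v). L z w v" "L' k"] L'[OF k] by simp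
  have "((\<lambda>u'. \<Sum>k<N. L (kap u' k) (om u' (Suc k)) (u' $ stage k)) has_derivative
      (\<lambda>h. \<Sum>k<N. L' k (dk k h, dw (Suc k) h, h $ stage k))) (at u)"
    by (intro has_derivative_sum dL) simp
  then have dE: "(E has_derivative (\<lambda>h. \<Sum>k<N. L' k (dk k h, dw (Suc k) h, h $ stage k))) (at u)"
    by (rule has_derivative_eventually_eq) (rule E)

  have "(\<Sum>k<N. L' k (dk k h, dw (Suc k) h, h $ stage k)) = h \<bullet> \<sigma>" for h
  proof -
    define T where "T k = dk k h \<bullet> b k - dw k h \<bullet> a k" for k
    have step: "L' k (dk k h, dw (Suc k) h, h $ stage k) - h $ stage k \<bullet> \<sigma> $ stage k = T (Suc k) - T k"
      if k: "k < N" for k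
    proof -
      note pG = partial_derivatives3[OF G'[OF k], THEN inner_nabla]
      note pL = partial_derivatives3[OF L'[OF k], THEN inner_grad]
      note pF = partial_derivatives2[OF F'[OF k], THEN inner_nabla]
      have s: "h $ stage k \<bullet> \<sigma> $ stage k = L' k (0, 0, h $ stage k)
          - G' k (0, 0, h $ stage k) \<bullet> a k - F' k (0, h $ stage k) \<bullet> b (Suc k)"
        unfolding sigma[OF k] by (simp only: inner_diff_right pG pL pF)
      have bk: "dk k h \<bullet> b k = G' k (dk k h, 0, 0) \<bullet> a k + F' k (dk k h, 0) \<bullet> b (Suc k) - L' k (dk k h, 0, 0)"
        unfolding b_step[OF k] by (simp only: inner_diff_right inner_add_right pG pL pF)
      have ak: "dw (Suc k) h \<bullet> a (Suc k) = G' k (0, dw (Suc k) h, 0) \<bullet> a k - L' k (0, dw (Suc k) h, 0)"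
        unfolding a_step[OF k] by (simp only: inner_diff_right pG pL)
      show ?thesis
        unfolding T_def s bk ak
          linear_split3[OF has_derivative_linear[OF L'[OF k]], of "dk k h" "dw (Suc k) h"]
          dw_step[OF k, of h] dk_Suc[OF k, of h]
        by (simp add: inner_add_left)
    qed
    have "T 0 = 0" by (simp add: T_def dk_0 a_0)
    moreover have "T N = 0"
      unfolding T_def b_N inner_nabla[OF M'] dw_N by simp
    ultimately have "(\<Sum>k<N. T (Suc k) - T k) = 0"
      by (simp add: sum_lessThan_telescope)
    moreover have "(\<Sum>k<N. T (Suc k) - T k)
        = (\<Sum>k<N. L' k (dk k h, dw (Suc k) h, h $ stage k) - h $ stage k \<bullet> \<sigma> $ stage k)"
      by (rule sum.cong) (simp_all only: lessThan_iff step)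
    ultimately have "(\<Sum>k<N. L' k (dk k h, dw (Suc k) h, h $ stage k)) = (\<Sum>k<N. h $ stage k \<bullet> \<sigma> $ stage k)"
      by (simp only: sum_subtractf)
    also have "\<dots> = h \<bullet> \<sigma>"
      unfolding inner_vec_def using sum.reindex_bij_betw[OF stage, of "\<lambda>i. h $ i \<bullet> \<sigma> $ i"] by simp
    finally show ?thesis .
  qed
  with dE show ?thesis by (simp add: gderiv_def)
qed

section \<open>Symmetry of second derivatives\<close>

text \<open>
  Two applications of the mean value theorem show that the second difference of \<open>\<phi>\<close> along \<open>t p\<close> and
  \<open>t q\<close> is \<open>t\<^sup>2\<close> times the second derivative, in the order \<open>p, q\<close>, at a point that tends to \<open>z\<close> as
  \<open>t\<close> tends to \<open>0\<close>. The second difference is symmetric in \<open>p\<close> and \<open>q\<close>, so both orders of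
  differentiation have the same limit.
\<close>

lemma symmetric_second_derivative:
  fixes \<phi> :: "'a::real_normed_vector \<Rightarrow> real"
  assumes d1: "\<And>z. (\<phi> has_derivative \<phi>' z) (at z)"
    and d2: "\<And>z p. ((\<lambda>z. \<phi>' z p) has_derivative \<phi>'' z p) (at z)"
    and cont: "\<And>p q. isCont (\<lambda>z. \<phi>'' z p q) z"
  shows "\<phi>'' z p q = \<phi>'' z q p"
proof -
  have mean: "\<exists>s r. 0 < s \<and> s < t \<and> 0 < r \<and> r < t \<and>
      \<phi> (z + t *\<^sub>R p + t *\<^sub>R q) - \<phi> (z + t *\<^sub>R p) - \<phi> (z + t *\<^sub>R q) + \<phi> z
        = t * t * \<phi>'' (z + s *\<^sub>R p + r *\<^sub>R q) p q" if t: "t > 0" for t p q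
  proof -
    have line: "((\<lambda>s. f (c + s *\<^sub>R e)) has_real_derivative f' e) (at s)"
      if "(f has_derivative f') (at (c + s *\<^sub>R e))" for f :: "'a \<Rightarrow> real" and f' c e s
    proof -
      have "((\<lambda>s. c + s *\<^sub>R e) has_derivative (\<lambda>h. h *\<^sub>R e)) (at s)"
        by (auto intro!: derivative_eq_intros)
      from has_derivative_compose[OF this that]
      have "((\<lambda>s. f (c + s *\<^sub>R e)) has_derivative (\<lambda>h. f' (h *\<^sub>R e))) (at s)" .
      then show ?thesis
        using linear_scale[OF has_derivative_linear[OF that]]
        by (simp add: has_field_derivative_def mult_commute_abs)
    qed
    \<comment> \<open>the second difference is \<open>g t - g 0\<close>, an increment along \<open>p\<close> of an increment along \<open>q\<close>\<close>
    define g where "g s = \<phi> ((z + t *\<^sub>R q) + s *\<^sub>R p) - \<phi> (z + s *\<^sub>R p)" for s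
    have "(g has_real_derivative (\<phi>' ((z + t *\<^sub>R q) + s *\<^sub>R p) p - \<phi>' (z + s *\<^sub>R p) p)) (at s)" for s
      unfolding g_def by (intro DERIV_diff line d1)
    then obtain s where s: "0 < s" "s < t"
      "g t - g 0 = t * (\<phi>' ((z + t *\<^sub>R q) + s *\<^sub>R p) p - \<phi>' (z + s *\<^sub>R p) p)"
      using MVT2[of 0 t g "\<lambda>s. \<phi>' ((z + t *\<^sub>R q) + s *\<^sub>R p) p - \<phi>' (z + s *\<^sub>R p) p"] t by auto
    define k where "k r = \<phi>' ((z + s *\<^sub>R p) + r *\<^sub>R q) p" for r
    have "(k has_real_derivative \<phi>'' ((z + s *\<^sub>R p) + r *\<^sub>R q) p q) (at r)" for r
      unfolding k_def by (intro line d2)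
    then obtain r where r: "0 < r" "r < t" "k t - k 0 = t * \<phi>'' ((z + s *\<^sub>R p) + r *\<^sub>R q) p q"
      using MVT2[of 0 t k "\<lambda>r. \<phi>'' ((z + s *\<^sub>R p) + r *\<^sub>R q) p q"] t by auto
    have "g t - g 0 = t * (k t - k 0)"
      using s(3) by (simp add: k_def algebra_simps)
    with r s show ?thesis
      by (intro exI[of _ s] exI[of _ r]) (simp add: g_def algebra_simps)
  qed
  have lim: "\<exists>s r. (\<lambda>n. \<phi>'' (z + s n *\<^sub>R p + r n *\<^sub>R q) p q) \<longlonglongrightarrow> \<phi>'' z p q \<and>
     (\<forall>n. (\<phi> (z + (1/Suc n) *\<^sub>R p + (1/Suc n) *\<^sub>R q) - \<phi> (z + (1/Suc n) *\<^sub>R p) - \<phi> (z + (1/Suc n) *\<^sub>R q) + \<phi> z)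
          = (1/Suc n) * (1/Suc n) * \<phi>'' (z + s n *\<^sub>R p + r n *\<^sub>R q) p q)" for p q
  proof -
    have "\<forall>n. \<exists>s r. 0 < s \<and> s < 1/Suc n \<and> 0 < r \<and> r < 1/Suc n \<and>
      \<phi> (z + (1/Suc n) *\<^sub>R p + (1/Suc n) *\<^sub>R q) - \<phi> (z + (1/Suc n) *\<^sub>R p) - \<phi> (z + (1/Suc n) *\<^sub>R q) + \<phi> z
        = (1/Suc n) * (1/Suc n) * \<phi>'' (z + s *\<^sub>R p + r *\<^sub>R q) p q"
      by (intro allI mean) simp
    then obtain s r where sr: "\<And>n. 0 < s n \<and> s n < 1/Suc n \<and> 0 < r n \<and> r n < 1/Suc n \<and>
      \<phi> (z + (1/Suc n) *\<^sub>R p + (1/Suc n) *\<^sub>R q) - \<phi> (z + (1/Suc n) *\<^sub>R p) - \<phi> (z + (1/Suc n) *\<^sub>R q) + \<phi> z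
        = (1/Suc n) * (1/Suc n) * \<phi>'' (z + s n *\<^sub>R p + r n *\<^sub>R q) p q"
      by metis
    have null: "(\<lambda>n. 1 / real (Suc n)) \<longlonglongrightarrow> 0"
      using LIMSEQ_inverse_real_of_nat by (simp add: inverse_eq_divide)
    have "s \<longlonglongrightarrow> 0" "r \<longlonglongrightarrow> 0"
      using sr by (auto intro!: tendsto_sandwich[OF _ _ tendsto_const null] always_eventually less_imp_le)
    then have "(\<lambda>n. z + s n *\<^sub>R p + r n *\<^sub>R q) \<longlonglongrightarrow> z + 0 *\<^sub>R p + 0 *\<^sub>R q"
      by (intro tendsto_intros)
    then have "(\<lambda>n. \<phi>'' (z + s n *\<^sub>R p + r n *\<^sub>R q) p q) \<longlonglongrightarrow> \<phi>'' z p q"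
      using isCont_tendsto_compose[OF cont] by simp
    with sr show ?thesis by blast
  qed
  \<comment> \<open>the same second difference, with \<open>p\<close> and \<open>q\<close> in either order\<close>
  obtain s r where 1: "(\<lambda>n. \<phi>'' (z + s n *\<^sub>R p + r n *\<^sub>R q) p q) \<longlonglongrightarrow> \<phi>'' z p q"
     "\<And>n. (\<phi> (z + (1/Suc n) *\<^sub>R p + (1/Suc n) *\<^sub>R q) - \<phi> (z + (1/Suc n) *\<^sub>R p) - \<phi> (z + (1/Suc n) *\<^sub>R q) + \<phi> z)
          = (1/Suc n) * (1/Suc n) * \<phi>'' (z + s n *\<^sub>R p + r n *\<^sub>R q) p q"
    using lim[of p q] by blast
  obtain s' r' where 2: "(\<lambda>n. \<phi>'' (z + s' n *\<^sub>R q + r' n *\<^sub>R p) q p) \<longlonglongrightarrow> \<phi>'' z q p"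
     "\<And>n. (\<phi> (z + (1/Suc n) *\<^sub>R q + (1/Suc n) *\<^sub>R p) - \<phi> (z + (1/Suc n) *\<^sub>R q) - \<phi> (z + (1/Suc n) *\<^sub>R p) + \<phi> z)
          = (1/Suc n) * (1/Suc n) * \<phi>'' (z + s' n *\<^sub>R q + r' n *\<^sub>R p) q p"
    using lim[of q p] by blast
  have "\<phi>'' (z + s n *\<^sub>R p + r n *\<^sub>R q) p q = \<phi>'' (z + s' n *\<^sub>R q + r' n *\<^sub>R p) q p" for n
  proof -
    have sw: "z + (1/Suc n) *\<^sub>R q + (1/Suc n) *\<^sub>R p = z + (1/Suc n) *\<^sub>R p + (1/Suc n) *\<^sub>R q" by simp
    have "(1/real (Suc n)) * (1/Suc n) * \<phi>'' (z + s n *\<^sub>R p + r n *\<^sub>R q) p q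
        = (1/Suc n) * (1/Suc n) * \<phi>'' (z + s' n *\<^sub>R q + r' n *\<^sub>R p) q p"
      unfolding 1(2)[of n, symmetric] 2(2)[of n, symmetric] sw by (simp add: algebra_simps)
    then show ?thesis by simp
  qed
  with 1(1) 2(1) show ?thesis using LIMSEQ_unique by simp
qed

section \<open>Differentiability of matrix operations\<close>

lemma differentiable_vec_lambda:
  fixes f :: "'a::real_normed_vector \<Rightarrow> 'i::finite \<Rightarrow> 'b::euclidean_space"
  assumes "\<And>i. (\<lambda>x. f x i) differentiable F"
  shows "(\<lambda>x. \<chi> i. f x i) differentiable F"
proof -
  have "bounded_linear (axis i :: 'b \<Rightarrow> 'b^'i)" for i :: 'i
    by (intro linear_conv_bounded_linear[THEN iffD1] linearI) (auto simp: axis_def vec_eq_iff)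
  then have "(\<lambda>x. \<Sum>i\<in>UNIV. axis i (f x i)) differentiable F"
    using assms bounded_linear.has_derivative
    by (intro differentiable_sum) (auto simp: differentiable_def, blast)
  moreover have "(\<Sum>i\<in>UNIV. axis i (f x i)) = (\<chi> i. f x i)" for x
    by (simp add: vec_eq_iff axis_def)
  ultimately show ?thesis by simp
qed

lemma has_derivative_vec_lambda:
  fixes f :: "'a::real_normed_vector \<Rightarrow> 'i::finite \<Rightarrow> real"
  assumes "\<And>i. ((\<lambda>x. f x i) has_derivative (\<lambda>h. f' h i)) (at x)"
  shows "((\<lambda>x. \<chi> i. f x i) has_derivative (\<lambda>h. \<chi> i. f' h i)) (at x)"
  unfolding has_derivative_componentwise_within[of "\<lambda>x. \<chi> i. f x i"]
  using assms by (auto simp: Basis_vec_def inner_axis)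

lemma differentiable_bounded_linear:
  assumes "bounded_linear l" "f differentiable F"
  shows "(\<lambda>x. l (f x)) differentiable F"
  using bounded_linear.has_derivative[OF assms(1)] assms(2) unfolding differentiable_def by blast

lemmas differentiable_vec_nth = differentiable_bounded_linear[OF bounded_linear_vec_nth]
lemmas differentiable_fst = differentiable_bounded_linear[OF bounded_linear_fst]
lemmas differentiable_snd = differentiable_bounded_linear[OF bounded_linear_snd]

lemma differentiable_Pair:
  assumes "f differentiable (at x)" "g differentiable (at x)"
  shows "(\<lambda>x. (f x, g x)) differentiable (at x)"
  using assms has_derivative_Pair unfolding differentiable_def by blast

lemma differentiable_inner_at:
  fixes f g :: "'a::real_normed_vector \<Rightarrow> 'b::real_inner"
  assumes "f differentiable (at x)" "g differentiable (at x)"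
  shows "(\<lambda>x. f x \<bullet> g x) differentiable (at x)"
  using assms by (auto simp: differentiable_def intro: has_derivative_inner)

lemma differentiable_prod_at:
  fixes f :: "'i \<Rightarrow> 'a::real_normed_vector \<Rightarrow> real"
  assumes "\<And>i. i \<in> I \<Longrightarrow> f i differentiable (at x)"
  shows "(\<lambda>x. \<Prod>i\<in>I. f i x) differentiable (at x)"
  using assms by (induct I rule: infinite_finite_induct) auto

lemmas differentiable_rules = differentiable_vec_lambda differentiable_vec_nth differentiable_mult

lemma differentiable_matrix_mul:
  fixes A :: "'a::real_normed_vector \<Rightarrow> real^'k^'i" and B :: "'a \<Rightarrow> real^'j^'k"
  assumes "A differentiable (at x)" "B differentiable (at x)"
  shows "(\<lambda>x. A x ** B x) differentiable (at x)"
  unfolding matrix_matrix_mult_def using assms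
  by (intro differentiable_rules differentiable_sum ballI) auto

lemma differentiable_matrix_vector_mul:
  fixes A :: "'a::real_normed_vector \<Rightarrow> real^'k^'i" and b :: "'a \<Rightarrow> real^'k"
  assumes "A differentiable (at x)" "b differentiable (at x)"
  shows "(\<lambda>x. A x *v b x) differentiable (at x)"
  unfolding matrix_vector_mult_def using assms
  by (intro differentiable_rules differentiable_sum ballI) auto

lemma differentiable_transpose:
  fixes A :: "'a::real_normed_vector \<Rightarrow> real^'k^'i"
  assumes "A differentiable (at x)"
  shows "(\<lambda>x. transpose (A x)) differentiable (at x)"
  unfolding transpose_def using assms by (intro differentiable_rules)

lemma differentiable_trace:
  fixes A :: "'a::real_normed_vector \<Rightarrow> real^'i^'i"
  assumes "A differentiable (at x)"
  shows "(\<lambda>x. trace (A x)) differentiable (at x)"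
  unfolding trace_def using assms by (intro differentiable_rules differentiable_sum ballI) auto

lemma differentiable_det:
  fixes A :: "'a::real_normed_vector \<Rightarrow> real^'i^'i"
  assumes "\<And>i j. (\<lambda>x. A x $ i $ j) differentiable (at x)"
  shows "(\<lambda>x. det (A x)) differentiable (at x)"
  unfolding det_def using assms
  by (intro differentiable_sum ballI differentiable_mult differentiable_prod_at differentiable_const) auto

lemma matrix_inv_works:
  fixes A :: "real^'n^'n"
  assumes "invertible A"
  shows "A ** matrix_inv A = mat 1" "matrix_inv A ** A = mat 1"
proof -
  have "A ** matrix_inv A = mat 1 \<and> matrix_inv A ** A = mat 1"
    unfolding matrix_inv_def by (rule someI_ex) (use assms in \<open>auto simp: invertible_def\<close>)
  then show "A ** matrix_inv A = mat 1" "matrix_inv A ** A = mat 1" by auto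
qed

lemma eventually_invertible:
  fixes A :: "'a::real_normed_vector \<Rightarrow> real^'n^'n"
  assumes "A differentiable (at x)" "invertible (A x)"
  shows "eventually (\<lambda>y. invertible (A y)) (nhds x)"
proof -
  have "(\<lambda>y. det (A y)) differentiable (at x)"
    by (intro differentiable_det differentiable_vec_nth assms)
  then have "isCont (\<lambda>y. det (A y)) x" by (rule differentiable_imp_continuous_within)
  then have "((\<lambda>y. det (A y)) \<longlongrightarrow> det (A x)) (nhds x)"
    unfolding isCont_def by (rule tendsto_at_iff_tendsto_nhds[of "\<lambda>y. det (A y)", THEN iffD1])
  then have "eventually (\<lambda>y. det (A y) \<noteq> 0) (nhds x)"
    by (rule tendsto_imp_eventually_ne) (use assms(2) in \<open>simp add: invertible_det_nz\<close>)
  then show ?thesis by (simp add: invertible_det_nz)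
qed

text \<open>
  Cramer's rule writes the inverse as a rational function of the entries; this is what makes
  inversion differentiable at an invertible matrix.
\<close>

lemma matrix_inv_cramer:
  fixes A :: "real^'n^'n"
  assumes "invertible A"
  shows "matrix_inv A $ k $ l
    = det (\<chi> i j. if j = k then axis l 1 $ i else A $ i $ j) / det A"
proof -
  have "A *v (matrix_inv A *v axis l 1) = axis l 1"
    by (simp add: matrix_vector_mul_assoc matrix_inv_works[OF assms])
  then have "matrix_inv A *v axis l 1
      = (\<chi> k. det (\<chi> i j. if j = k then axis l 1 $ i else A $ i $ j) / det A)"
    using cramer[of A "matrix_inv A *v axis l 1" "axis l 1"] assms[unfolded invertible_det_nz] by blast
  then show ?thesis
    by (simp add: matrix_vector_mul_component vec_eq_iff matrix_vector_mult_basis column_def)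
qed

lemma differentiable_matrix_inv:
  fixes A :: "'a::real_normed_vector \<Rightarrow> real^'n^'n"
  assumes "A differentiable (at x)" "invertible (A x)"
  shows "(\<lambda>x. matrix_inv (A x)) differentiable (at x)"
proof (rule eventually_eq_differentiable)
  show "eventually (\<lambda>y. matrix_inv (A y) = (\<chi> k l. det (\<chi> i j. if j = k then axis l 1 $ i else A y $ i $ j) / det (A y)))
      (nhds x)"
    using eventually_invertible[OF assms] by eventually_elim (simp add: vec_eq_iff matrix_inv_cramer)
  have entry: "(\<lambda>y. (\<chi> i j. if j = k then axis l 1 $ i else A y $ i $ j) $ p $ q) differentiable (at x)"
    for k l p q :: 'n
    using assms(1) by (cases "q = k") (auto intro!: differentiable_vec_nth)
  show "(\<lambda>y. \<chi> k l. det (\<chi> i j. if j = k then axis l 1 $ i else A y $ i $ j) / det (A y)) differentiable (at x)"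
    using assms(2) unfolding invertible_det_nz
    by (intro differentiable_vec_lambda differentiable_divide differentiable_det entry)
       (auto intro!: differentiable_vec_nth assms(1))
qed

section \<open>Positive semidefinite matrices and vectorization\<close>

lemma matrix_inv_symmetric:
  fixes A :: "real^'n^'n"
  assumes "invertible A" "transpose A = A"
  shows "transpose (matrix_inv A) = matrix_inv A"
proof -
  have "transpose (matrix_inv A) = transpose (matrix_inv A) ** (A ** matrix_inv A)"
    by (simp add: matrix_inv_works[OF assms(1)])
  also have "\<dots> = transpose (A ** matrix_inv A) ** matrix_inv A"
    by (simp add: matrix_mul_assoc matrix_transpose_mul assms(2))
  finally show ?thesis by (simp add: matrix_inv_works[OF assms(1)])
qed

lemma transpose_add: "transpose (A + B) = transpose A + transpose (B :: 'a::ab_group_add^'n^'m)"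
  by (simp add: transpose_def vec_eq_iff)

lemma transpose_diff: "transpose (A - B) = transpose A - transpose (B :: 'a::ab_group_add^'n^'m)"
  by (simp add: transpose_def vec_eq_iff)

lemma transpose_conj:
  fixes A :: "real^'n^'m" and S :: "real^'n^'n"
  assumes "transpose S = S"
  shows "transpose (A ** S ** transpose A) = A ** S ** transpose A"
  by (simp add: matrix_transpose_mul matrix_mul_assoc assms)

lemma inner_transpose:
  fixes A :: "real^'n^'m"
  shows "x \<bullet> (transpose A *v y) = (A *v x) \<bullet> y"
  by (metis dot_lmul_matrix inner_commute transpose_matrix_vector)

lemma posdef_invertible:
  assumes "posdef A"
  shows "invertible A"
  unfolding invertible_left_inverse matrix_left_invertible_ker
  using assms by (force simp: posdef_def)

lemma inner_conj:
  fixes A :: "real^'n^'m"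
  shows "x \<bullet> ((A ** S ** transpose A) *v x) = (transpose A *v x) \<bullet> (S *v (transpose A *v x))"
  using inner_transpose[of x "transpose A" "S *v (transpose A *v x)"]
  by (simp add: matrix_vector_mul_assoc matrix_mul_assoc del: transpose_matrix_vector)

lemma psd_conj_add_posdef:
  fixes C :: "real^'n^'e"
  assumes "psd S" "posdef V"
  shows "posdef (C ** S ** transpose C + V)"
proof -
  have "0 < x \<bullet> ((C ** S ** transpose C + V) *v x)" if "x \<noteq> 0" for x
  proof -
    have "0 \<le> x \<bullet> ((C ** S ** transpose C) *v x)"
      unfolding inner_conj using assms(1) by (simp add: psd_def del: transpose_matrix_vector)
    then show ?thesis
      using assms(2) that
      by (simp add: posdef_def matrix_vector_mult_add_rdistrib inner_add_right add_nonneg_pos)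
  qed
  then show ?thesis
    using assms by (simp add: posdef_def psd_def transpose_add transpose_conj)
qed

lemma psd_conj:
  fixes A :: "real^'n^'m"
  assumes "psd S"
  shows "psd (A ** S ** transpose A)"
  unfolding psd_def inner_conj
  using assms by (simp add: psd_def transpose_conj del: transpose_matrix_vector)

lemma psd_add: "psd A \<Longrightarrow> psd B \<Longrightarrow> psd (A + B)"
  by (simp add: psd_def transpose_add matrix_vector_mult_add_rdistrib inner_add_right)

text \<open>
  The variance that remains after a measurement is a Schur complement. With \<open>M = C S C\<^sup>T + V\<close>, the
  quadratic \<open>(x - C\<^sup>T w) \<bullet> S (x - C\<^sup>T w) + w \<bullet> V w\<close> in \<open>w\<close> is nonnegative, and its value at the
  minimizer \<open>w = M\<^sup>-\<^sup>1 C S x\<close> is the quadratic form of the Schur complement at \<open>x\<close>.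
\<close>

lemma psd_conditional_variance:
  fixes C :: "real^'n^'e"
  assumes S: "psd S" and V: "posdef V"
  shows "psd (S - S ** transpose C ** matrix_inv (C ** S ** transpose C + V) ** C ** S)"
proof -
  define M where "M = C ** S ** transpose C + V"
  define K where "K = S ** transpose C ** matrix_inv M ** C ** S"
  have M: "posdef M" unfolding M_def by (rule psd_conj_add_posdef[OF S V])
  have invM: "invertible M" by (rule posdef_invertible[OF M])
  have symS: "transpose S = S" and symM: "transpose M = M"
    using S M by (auto simp: psd_def posdef_def)
  have S_swap: "x \<bullet> (S *v y) = (S *v x) \<bullet> y" for x y
    using inner_transpose[of x S y] unfolding symS .
  have "transpose K = K"
    by (simp add: K_def matrix_transpose_mul symS matrix_inv_symmetric[OF invM symM] matrix_mul_assoc)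
  then have sym: "transpose (S - K) = S - K" by (simp add: transpose_diff symS)
  have "0 \<le> x \<bullet> ((S - K) *v x)" for x
  proof -
    define q where "q = C *v (S *v x)"
    define w where "w = matrix_inv M *v q"
    define e where "e = x - transpose C *v w"
    have Mw: "M *v w = q"
      by (simp add: w_def matrix_vector_mul_assoc matrix_inv_works[OF invM])
    have Kx: "x \<bullet> (K *v x) = q \<bullet> w"
    proof -
      have "K *v x = S *v (transpose C *v w)"
        by (simp add: K_def w_def q_def matrix_vector_mul_assoc matrix_mul_assoc del: transpose_matrix_vector)
      then show ?thesis
        by (simp add: S_swap inner_transpose q_def del: transpose_matrix_vector)
    qed
    have a: "(transpose C *v w) \<bullet> (S *v x) = q \<bullet> w"
      by (simp only: inner_commute[of "transpose C *v w"] inner_transpose q_def)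
    have b: "x \<bullet> (S *v (transpose C *v w)) = q \<bullet> w"
      by (simp only: S_swap inner_transpose q_def)
    have c: "(transpose C *v w) \<bullet> (S *v (transpose C *v w)) + w \<bullet> (V *v w) = q \<bullet> w"
    proof -
      have "M *v w = C *v (S *v (transpose C *v w)) + V *v w"
        by (simp add: M_def matrix_vector_mult_add_rdistrib matrix_vector_mul_assoc matrix_mul_assoc del: transpose_matrix_vector)
      moreover have "(transpose C *v w) \<bullet> (S *v (transpose C *v w)) = w \<bullet> (C *v (S *v (transpose C *v w)))"
        using inner_transpose[of "S *v (transpose C *v w)" C w] by (metis inner_commute)
      ultimately show ?thesis
        using Mw by (metis inner_add_right inner_commute)
    qed
    have "e \<bullet> (S *v e) = x \<bullet> (S *v x) - x \<bullet> (S *v (transpose C *v w))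
        - (transpose C *v w) \<bullet> (S *v x) + (transpose C *v w) \<bullet> (S *v (transpose C *v w))"
      by (simp add: e_def matrix_vector_mult_diff_distrib inner_diff_left inner_diff_right del: transpose_matrix_vector)
    then have "x \<bullet> ((S - K) *v x) = e \<bullet> (S *v e) + w \<bullet> (V *v w)"
      using a b c Kx by (simp add: matrix_vector_mult_diff_rdistrib inner_diff_right del: transpose_matrix_vector)
    moreover have "0 \<le> e \<bullet> (S *v e)" using S by (simp add: psd_def)
    moreover have "0 \<le> w \<bullet> (V *v w)"
      using V by (cases "w = 0") (auto simp: posdef_def less_imp_le)
    ultimately show ?thesis by simp
  qed
  with sym show ?thesis by (simp add: psd_def K_def M_def)
qed

lemma bounded_linear_unvech: "bounded_linear unvech"
  by (intro linear_conv_bounded_linear[THEN iffD1] linearI) (auto simp: unvech_def vec_eq_iff)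

lemma bounded_linear_vech: "bounded_linear vech"
  by (intro linear_conv_bounded_linear[THEN iffD1] linearI) (auto simp: vech_def vec_eq_iff Let_def)

lemma unvecOm_vecOm: "transpose (snd Om) = snd Om \<Longrightarrow> unvecOm (vecOm Om) = Om"
  by (simp add: unvecOm_def vecOm_def unvech_vech)

lemma vecOm_differentiable:
  "Om differentiable (at t) \<Longrightarrow> (\<lambda>t. vecOm (Om t)) differentiable (at t)"
  unfolding vecOm_def
  by (intro differentiable_Pair differentiable_fst differentiable_snd
      differentiable_bounded_linear[OF bounded_linear_vech])

lemma unvecOm_differentiable:
  "om differentiable (at t) \<Longrightarrow> (\<lambda>t. unvecOm (om t)) differentiable (at t)"
  unfolding unvecOm_def
  by (intro differentiable_Pair differentiable_fst differentiable_snd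
      differentiable_bounded_linear[OF bounded_linear_unvech])

definition stacked_state :: "('n::finite, 'm::finite, 'e::finite) ocp \<Rightarrow>
    (nat \<Rightarrow> real^'m) \<Rightarrow> real^'n \<Rightarrow> real^'n^'n \<Rightarrow> nat \<Rightarrow> 'n stacked" where
  "stacked_state D us x0 S0 k = (state D us x0 k, vech (variance D us x0 S0 k))"

section \<open>Derivatives of the problem data\<close>

lemma jacobian_entry:
  fixes f :: "real^'j \<Rightarrow> real^'i"
  assumes "(f has_derivative f') (at x)"
  shows "jacobian f (at x) $ i $ j = f' (axis j 1) $ i"
  by (simp add: jacobian_def matrix_def frechet_derivative_at[OF assms, symmetric])

lemma grad_entry:
  fixes f :: "real^'i \<Rightarrow> real"
  assumes "(f has_derivative f') (at x)"
  shows "grad f x $ i = f' (axis i 1)"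
  using inner_grad[OF assms, of "axis i 1"] by (simp add: inner_axis')

lemma has_derivative_quadratic_form:
  fixes S :: "real^'n^'n"
  assumes "transpose S = S"
  shows "((\<lambda>x. x \<bullet> (S *v x)) has_derivative (\<lambda>h. 2 * (h \<bullet> (S *v x)))) (at x)"
proof -
  have "((\<lambda>x. S *v x) has_derivative (\<lambda>h. S *v h)) (at x)"
    by (intro bounded_linear_imp_has_derivative matrix_vector_mul_bounded_linear)
  from has_derivative_inner[OF has_derivative_ident this]
  have "((\<lambda>x. x \<bullet> (S *v x)) has_derivative (\<lambda>h. x \<bullet> (S *v h) + h \<bullet> (S *v x))) (at x)" .
  moreover have "x \<bullet> (S *v h) = h \<bullet> (S *v x)" for h
    using inner_transpose[of x S h] assms by (simp add: inner_commute)
  ultimately show ?thesis by simp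
qed

lemma open_admissible: "open {v. admissible D v}"
proof -
  have "{v. admissible D v} = (\<Inter>i. {v. u_lo D $ i < v $ i} \<inter> {v. v $ i < u_hi D $ i})"
    by (auto simp: admissible_def)
  moreover have "open {v :: real^'a. a < v $ i}" "open {v :: real^'a. v $ i < a}" for a :: real and i :: 'a
    by (intro open_Collect_less continuous_intros)+
  ultimately show ?thesis
    by (simp add: open_INT open_Int)
qed

text \<open>
  Here \<open>f1\<close> and \<open>f2\<close> are the first and second derivatives of the dynamics in \<open>(x, u)\<close>. The third
  derivative enters only as the derivative of \<open>f2\<close>: the Hessians of the dynamics occur in \<open>X\<close>, \<open>Y\<close>
  and \<open>Z\<close>, and these are differentiated once more.
\<close>

locale smooth_ocp =
  fixes D :: "('n::finite, 'm::finite, 'e::finite) ocp"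
    and f1 :: "((real^'n) \<times> (real^'m)) \<Rightarrow> (((real^'n) \<times> (real^'m)) \<Rightarrow>\<^sub>L (real^'n))"
    and f2 :: "((real^'n) \<times> (real^'m)) \<Rightarrow> ((real^'n) \<times> (real^'m)) \<Rightarrow>\<^sub>L ((real^'n) \<times> (real^'m)) \<Rightarrow>\<^sub>L (real^'n)"
  assumes f1: "\<And>z. ((\<lambda>(x, v). dyn D x v) has_derivative blinfun_apply (f1 z)) (at z)"
    and f2: "\<And>z. (f1 has_derivative blinfun_apply (f2 z)) (at z)"
    and f2_differentiable: "\<And>z. f2 differentiable (at z)"
    and Q_sym: "transpose (Qmat D) = Qmat D"
    and R_sym: "transpose (Rmat D) = Rmat D"
    and PN_sym: "transpose (PNmat D) = PNmat D"
    and W_psd: "psd (Wmat D)"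
    and V_posdef: "posdef (Vmat D)"
begin

lemma dyn_differentiable:
  assumes "x differentiable (at t)" "v differentiable (at t)"
  shows "(\<lambda>t. dyn D (x t) (v t)) differentiable (at t)"
proof -
  have "(\<lambda>(x, v). dyn D x v) differentiable (at (x t, v t))"
    using f1 by (rule differentiableI)
  from differentiable_compose[where g="\<lambda>t. (x t, v t)", OF this differentiable_Pair[OF assms]]
  show ?thesis by simp
qed

lemma f1_differentiable:
  assumes "x differentiable (at t)" "v differentiable (at t)"
  shows "(\<lambda>t. f1 (x t, v t) p) differentiable (at t)"
proof -
  have "f1 differentiable (at (x t, v t))"
    using f2 by (rule differentiableI)
  from differentiable_compose[where g="\<lambda>t. (x t, v t)", OF this differentiable_Pair[OF assms]]
  show ?thesis by (rule differentiable_bounded_linear[OF blinfun.bounded_linear_left])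
qed

lemma f2_compose_differentiable:
  assumes "x differentiable (at t)" "v differentiable (at t)"
  shows "(\<lambda>t. f2 (x t, v t) p q) differentiable (at t)"
proof -
  have "(\<lambda>t. f2 (x t, v t)) differentiable (at t)"
    using differentiable_compose[where g="\<lambda>t. (x t, v t)", OF f2_differentiable differentiable_Pair[OF assms]] .
  then show ?thesis
    by (intro differentiable_bounded_linear[OF blinfun.bounded_linear_left])
qed

lemma f1_partial:
  "((\<lambda>x. lam \<bullet> f1 (x, v) p) has_derivative (\<lambda>h. lam \<bullet> f2 (x, v) (h, 0) p)) (at x)"
  "((\<lambda>v. lam \<bullet> f1 (x, v) p) has_derivative (\<lambda>h. lam \<bullet> f2 (x, v) (0, h) p)) (at v)"
proof -
  have "((\<lambda>z. lam \<bullet> f1 z p) has_derivative (\<lambda>h. lam \<bullet> f2 (x, v) h p)) (at (x, v))"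
    by (intro has_derivative_inner_right bounded_linear.has_derivative[OF blinfun.bounded_linear_left] f2)
  then have "((\<lambda>(x, v). lam \<bullet> f1 (x, v) p) has_derivative (\<lambda>h. lam \<bullet> f2 (x, v) h p)) (at (x, v))"
    by (simp add: case_prod_beta')
  from partial_derivatives2[OF this]
  show "((\<lambda>x. lam \<bullet> f1 (x, v) p) has_derivative (\<lambda>h. lam \<bullet> f2 (x, v) (h, 0) p)) (at x)"
    "((\<lambda>v. lam \<bullet> f1 (x, v) p) has_derivative (\<lambda>h. lam \<bullet> f2 (x, v) (0, h) p)) (at v)" .
qed

text \<open>
  Without this symmetry \<open>Y\<close> and \<open>Z\<close>, and with them the matrix \<open>P\<close> of the backward recursion, would
  not be symmetric, and \<open>vech\<close> would lose information.
\<close>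

lemma f2_symmetric: "lam \<bullet> f2 z p q = lam \<bullet> f2 z q p"
proof (rule symmetric_second_derivative[where \<phi>="\<lambda>z. lam \<bullet> (\<lambda>(x, v). dyn D x v) z" and
      \<phi>'="\<lambda>z p. lam \<bullet> f1 z p" and \<phi>''="\<lambda>z p q. lam \<bullet> f2 z q p", symmetric])
  show "((\<lambda>z. lam \<bullet> (\<lambda>(x, v). dyn D x v) z) has_derivative (\<lambda>p. lam \<bullet> f1 z p)) (at z)" for z
    by (intro has_derivative_inner_right f1)
  show "((\<lambda>z. lam \<bullet> f1 z p) has_derivative (\<lambda>q. lam \<bullet> f2 z q p)) (at z)" for z p
    by (intro has_derivative_inner_right bounded_linear.has_derivative[OF blinfun.bounded_linear_left] f2)
  have "isCont f2 z" by (rule differentiable_imp_continuous_within[OF f2_differentiable])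
  then show "isCont (\<lambda>z. lam \<bullet> f2 z q p) z" for p q
    by (intro continuous_intros)
qed

lemma Amat_entry: "Amat D x v $ i $ j = f1 (x, v) (axis j 1, 0) $ i"
  unfolding Amat_def by (rule jacobian_entry[OF partial_derivatives2(1)[OF f1]])

lemma Bmat_entry: "Bmat D x v $ i $ j = f1 (x, v) (0, axis j 1) $ i"
  unfolding Bmat_def by (rule jacobian_entry[OF partial_derivatives2(2)[OF f1]])

lemma grad_x_hamiltonian:
  "grad (\<lambda>x'. hamiltonian D lam x' v) x = (\<chi> i. (Qmat D *v x) $ i + lam \<bullet> f1 (x, v) (axis i 1, 0))"
proof -
  have "((\<lambda>x'. hamiltonian D lam x' v) has_derivative
      (\<lambda>h. (2 * (h \<bullet> (Qmat D *v x)) + 0) / 2 - 0 + lam \<bullet> f1 (x, v) (h, 0))) (at x)"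
    unfolding hamiltonian_def barrier_cost_def stage_cost_def
    by (intro has_derivative_add has_derivative_diff has_derivative_const
        bounded_linear.has_derivative[OF bounded_linear_divide]
        has_derivative_quadratic_form[OF Q_sym]
        has_derivative_inner_right partial_derivatives2(1)[OF f1])
  from grad_entry[OF this] show ?thesis
    by (simp add: vec_eq_iff inner_axis')
qed

lemma has_derivative_log_barrier:
  assumes "admissible D v"
  shows "((\<lambda>v. \<Sum>i\<in>UNIV. ln ((v $ i - u_lo D $ i) * (u_hi D $ i - v $ i))) has_derivative
    (\<lambda>h. \<Sum>i\<in>UNIV. h $ i * (1 / (v $ i - u_lo D $ i) - 1 / (u_hi D $ i - v $ i)))) (at v)"
proof (rule has_derivative_sum)
  fix i
  have pos: "0 < v $ i - u_lo D $ i" "0 < u_hi D $ i - v $ i"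
    using assms by (auto simp: admissible_def)
  have nth: "((\<lambda>v. v $ i) has_derivative (\<lambda>h. h $ i)) (at v)"
    by (intro bounded_linear_imp_has_derivative bounded_linear_vec_nth)
  have "((\<lambda>s. ln ((s - u_lo D $ i) * (u_hi D $ i - s))) has_real_derivative
      (1 / (v $ i - u_lo D $ i) - 1 / (u_hi D $ i - v $ i))) (at (v $ i))"
    using pos mult_pos_pos[OF pos] by (auto intro!: derivative_eq_intros simp: field_simps)
  then have "((\<lambda>s. ln ((s - u_lo D $ i) * (u_hi D $ i - s))) has_derivative
      (\<lambda>h. h * (1 / (v $ i - u_lo D $ i) - 1 / (u_hi D $ i - v $ i)))) (at (v $ i))"
    by (simp add: has_field_derivative_def mult_commute_abs)
  from has_derivative_compose[OF nth this]
  show "((\<lambda>v. ln ((v $ i - u_lo D $ i) * (u_hi D $ i - v $ i))) has_derivative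
    (\<lambda>h. h $ i * (1 / (v $ i - u_lo D $ i) - 1 / (u_hi D $ i - v $ i)))) (at v)" .
qed

lemma grad_u_hamiltonian:
  assumes "admissible D v"
  shows "grad (\<lambda>v'. hamiltonian D lam x v') v =
    (\<chi> i. (Rmat D *v v) $ i - barrier D * (1 / (v $ i - u_lo D $ i) - 1 / (u_hi D $ i - v $ i))
      + lam \<bullet> f1 (x, v) (0, axis i 1))"
proof -
  have "((\<lambda>v'. hamiltonian D lam x v') has_derivative
      (\<lambda>h. (0 + 2 * (h \<bullet> (Rmat D *v v))) / 2
         - barrier D * (\<Sum>i\<in>UNIV. h $ i * (1 / (v $ i - u_lo D $ i) - 1 / (u_hi D $ i - v $ i)))
         + lam \<bullet> f1 (x, v) (0, h))) (at v)"
    unfolding hamiltonian_def barrier_cost_def stage_cost_def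
    by (intro has_derivative_add has_derivative_diff has_derivative_const has_derivative_mult_right
        bounded_linear.has_derivative[OF bounded_linear_divide]
        has_derivative_quadratic_form[OF R_sym] has_derivative_log_barrier[OF assms]
        has_derivative_inner_right partial_derivatives2(2)[OF f1])
  moreover have "(\<Sum>j\<in>UNIV. axis i 1 $ j * c j) = c i" for i :: 'm and c :: "'m \<Rightarrow> real"
    by (simp add: axis_def if_distrib[of "\<lambda>y. y * _"] cong: if_cong)
  ultimately show ?thesis
    by (simp add: vec_eq_iff inner_axis' grad_entry)
qed

lemma hess_xx_entry:
  "hess_xx (hamiltonian D lam) x v $ i $ j
     = Qmat D $ i $ j + lam \<bullet> f2 (x, v) (axis j 1, 0) (axis i 1, 0)"
proof -
  have "((\<lambda>x. (Qmat D *v x) $ i) has_derivative (\<lambda>h. (Qmat D *v h) $ i)) (at x)" for i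
    by (intro bounded_linear_imp_has_derivative bounded_linear_compose[OF bounded_linear_vec_nth]
        matrix_vector_mul_bounded_linear)
  then have "((grad (\<lambda>x'. hamiltonian D lam x' v)) has_derivative
      (\<lambda>h. \<chi> i. (Qmat D *v h) $ i + lam \<bullet> f2 (x, v) (h, 0) (axis i 1, 0))) (at x)"
    unfolding grad_x_hamiltonian[abs_def]
    by (intro has_derivative_vec_lambda has_derivative_add f1_partial)
  from jacobian_entry[OF this] show ?thesis
    by (simp add: hess_xx_def matrix_vector_mult_basis column_def)
qed

lemma hess_ux_entry:
  assumes "admissible D v"
  shows "hess_ux (hamiltonian D lam) x v $ i $ j = lam \<bullet> f2 (x, v) (axis j 1, 0) (0, axis i 1)"
proof -
  have "((\<lambda>x'. grad (\<lambda>v'. hamiltonian D lam x' v') v) has_derivative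
      (\<lambda>h. \<chi> i. 0 + lam \<bullet> f2 (x, v) (h, 0) (0, axis i 1))) (at x)"
    unfolding grad_u_hamiltonian[OF assms]
    by (intro has_derivative_vec_lambda has_derivative_add has_derivative_const f1_partial)
  from jacobian_entry[OF this] show ?thesis
    by (simp add: hess_ux_def)
qed

text \<open>
  The gradient formula is available only at admissible controls. These form an open set, so the
  formula can still be differentiated at each of them.
\<close>

lemma hess_uu_entry:
  assumes "admissible D v"
  shows "hess_uu (hamiltonian D lam) x v $ i $ j = Rmat D $ i $ j
     + barrier D * (1 / (v $ i - u_lo D $ i)^2 + 1 / (u_hi D $ i - v $ i)^2) * axis j 1 $ i
     + lam \<bullet> f2 (x, v) (0, axis j 1) (0, axis i 1)"
proof -
  let ?c = "\<lambda>i. barrier D * (1 / (v $ i - u_lo D $ i)^2 + 1 / (u_hi D $ i - v $ i)^2)"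
  have barrier': "((\<lambda>v. (Rmat D *v v) $ i - barrier D * (1 / (v $ i - u_lo D $ i) - 1 / (u_hi D $ i - v $ i)))
      has_derivative (\<lambda>h. (Rmat D *v h) $ i + ?c i * h $ i)) (at v)" for i
  proof -
    have pos: "0 < v $ i - u_lo D $ i" "0 < u_hi D $ i - v $ i"
      using assms by (auto simp: admissible_def)
    have nth: "((\<lambda>v. v $ i) has_derivative (\<lambda>h. h $ i)) (at v)"
      by (intro bounded_linear_imp_has_derivative bounded_linear_vec_nth)
    have "((\<lambda>s. - barrier D * (1 / (s - u_lo D $ i) - 1 / (u_hi D $ i - s))) has_real_derivative ?c i) (at (v $ i))"
      using pos by (auto intro!: derivative_eq_intros simp: field_simps power2_eq_square)
    then have "((\<lambda>s. - barrier D * (1 / (s - u_lo D $ i) - 1 / (u_hi D $ i - s))) has_derivative (\<lambda>h. ?c i * h)) (at (v $ i))"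
      by (simp add: has_field_derivative_def)
    note has_derivative_compose[OF nth this]
    moreover have "((\<lambda>v. (Rmat D *v v) $ i) has_derivative (\<lambda>h. (Rmat D *v h) $ i)) (at v)"
      by (intro bounded_linear_imp_has_derivative bounded_linear_compose[OF bounded_linear_vec_nth]
        matrix_vector_mul_bounded_linear)
    ultimately show ?thesis
      using has_derivative_add by fastforce
  qed
  have "((\<lambda>v. \<chi> i. (Rmat D *v v) $ i - barrier D * (1 / (v $ i - u_lo D $ i) - 1 / (u_hi D $ i - v $ i))
      + lam \<bullet> f1 (x, v) (0, axis i 1)) has_derivative
      (\<lambda>h. \<chi> i. (Rmat D *v h) $ i + ?c i * h $ i + lam \<bullet> f2 (x, v) (0, h) (0, axis i 1))) (at v)"
    by (intro has_derivative_vec_lambda has_derivative_add barrier' f1_partial)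
  moreover have "eventually (\<lambda>w. w \<in> {w. admissible D w}) (nhds v)"
    using assms open_admissible by (intro eventually_nhds_in_open) auto
  then have "eventually (\<lambda>w. grad (\<lambda>v'. hamiltonian D lam x v') w =
      (\<chi> i. (Rmat D *v w) $ i - barrier D * (1 / (w $ i - u_lo D $ i) - 1 / (u_hi D $ i - w $ i))
      + lam \<bullet> f1 (x, w) (0, axis i 1))) (nhds v)"
    by eventually_elim (simp add: grad_u_hamiltonian)
  ultimately have "((grad (\<lambda>v'. hamiltonian D lam x v')) has_derivative
      (\<lambda>h. \<chi> i. (Rmat D *v h) $ i + ?c i * h $ i + lam \<bullet> f2 (x, v) (0, h) (0, axis i 1))) (at v)"
    by (rule has_derivative_eventually_eq)
  from jacobian_entry[OF this] show ?thesis
    by (simp add: hess_uu_def matrix_vector_mult_basis column_def)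
qed

section \<open>Differentiability of the stage functions\<close>

lemma Amat_differentiable:
  assumes "x differentiable (at t)" "v differentiable (at t)"
  shows "(\<lambda>t. Amat D (x t) (v t)) differentiable (at t)"
proof -
  have "(\<lambda>t. \<chi> i j. Amat D (x t) (v t) $ i $ j) differentiable (at t)"
    unfolding Amat_entry using assms
    by (intro differentiable_vec_lambda differentiable_vec_nth f1_differentiable)
  then show ?thesis by (simp add: vec_lambda_eta)
qed

lemma Bmat_differentiable:
  assumes "x differentiable (at t)" "v differentiable (at t)"
  shows "(\<lambda>t. Bmat D (x t) (v t)) differentiable (at t)"
proof -
  have "(\<lambda>t. \<chi> i j. Bmat D (x t) (v t) $ i $ j) differentiable (at t)"
    unfolding Bmat_entry using assms
    by (intro differentiable_vec_lambda differentiable_vec_nth f1_differentiable)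
  then show ?thesis by (simp add: vec_lambda_eta)
qed

lemma eventually_admissible:
  assumes "v differentiable (at t)" "admissible D (v t)"
  shows "eventually (\<lambda>s. admissible D (v s)) (nhds t)"
proof -
  have "isCont v t" by (rule differentiable_imp_continuous_within[OF assms(1)])
  then have "(v \<longlongrightarrow> v t) (nhds t)"
    unfolding isCont_def by (rule tendsto_at_iff_tendsto_nhds[THEN iffD1])
  from topological_tendstoD[OF this open_admissible] show ?thesis
    using assms(2) by simp
qed

lemma hess_xx_differentiable:
  assumes "lam differentiable (at t)" "x differentiable (at t)" "v differentiable (at t)"
  shows "(\<lambda>t. hess_xx (hamiltonian D (lam t)) (x t) (v t)) differentiable (at t)"
proof -
  have "(\<lambda>t. \<chi> i j. hess_xx (hamiltonian D (lam t)) (x t) (v t) $ i $ j) differentiable (at t)"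
    unfolding hess_xx_entry using assms
    by (intro differentiable_vec_lambda differentiable_add differentiable_const
        differentiable_inner_at f2_compose_differentiable)
  then show ?thesis by (simp add: vec_lambda_eta)
qed

lemma hess_ux_differentiable:
  assumes "lam differentiable (at t)" "x differentiable (at t)" "v differentiable (at t)"
    and adm: "admissible D (v t)"
  shows "(\<lambda>t. hess_ux (hamiltonian D (lam t)) (x t) (v t)) differentiable (at t)"
proof (rule eventually_eq_differentiable)
  show "(\<lambda>t. \<chi> i j. lam t \<bullet> f2 (x t, v t) (axis j 1, 0) (0, axis i 1)) differentiable (at t)"
    using assms by (intro differentiable_vec_lambda differentiable_inner_at f2_compose_differentiable)
  show "eventually (\<lambda>t. hess_ux (hamiltonian D (lam t)) (x t) (v t) =
      (\<chi> i j. lam t \<bullet> f2 (x t, v t) (axis j 1, 0) (0, axis i 1))) (nhds t)"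
    using eventually_admissible[OF assms(3) adm]
    by eventually_elim (simp add: vec_eq_iff hess_ux_entry)
qed

lemma hess_uu_differentiable:
  assumes "lam differentiable (at t)" "x differentiable (at t)" "v differentiable (at t)"
    and adm: "admissible D (v t)"
  shows "(\<lambda>t. hess_uu (hamiltonian D (lam t)) (x t) (v t)) differentiable (at t)"
proof (rule eventually_eq_differentiable)
  have pos: "(v t $ i - u_lo D $ i)^2 \<noteq> 0" "(u_hi D $ i - v t $ i)^2 \<noteq> 0" for i
    using adm[unfolded admissible_def, rule_format, of i] by simp_all
  show "(\<lambda>t. \<chi> i j. Rmat D $ i $ j
     + barrier D * (1 / (v t $ i - u_lo D $ i)^2 + 1 / (u_hi D $ i - v t $ i)^2) * axis j 1 $ i
     + lam t \<bullet> f2 (x t, v t) (0, axis j 1) (0, axis i 1)) differentiable (at t)"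
    using assms(1-3) pos
    by (intro differentiable_vec_lambda differentiable_add differentiable_mult differentiable_divide
        differentiable_power differentiable_diff differentiable_const differentiable_vec_nth
        differentiable_inner_at f2_compose_differentiable)
  show "eventually (\<lambda>t. hess_uu (hamiltonian D (lam t)) (x t) (v t) = (\<chi> i j. Rmat D $ i $ j
     + barrier D * (1 / (v t $ i - u_lo D $ i)^2 + 1 / (u_hi D $ i - v t $ i)^2) * axis j 1 $ i
     + lam t \<bullet> f2 (x t, v t) (0, axis j 1) (0, axis i 1))) (nhds t)"
    using eventually_admissible[OF assms(3) adm]
    by eventually_elim (simp add: vec_eq_iff hess_uu_entry)
qed

lemma Xmat_differentiable:
  assumes "x differentiable (at t)" "v differentiable (at t)" "Om differentiable (at t)"
    and "admissible D (v t)"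
  shows "(\<lambda>t. Xmat D (x t) (v t) (Om t)) differentiable (at t)"
  unfolding Xmat_def case_prod_beta using assms
  by (intro differentiable_add differentiable_matrix_mul differentiable_transpose
      Amat_differentiable Bmat_differentiable hess_ux_differentiable differentiable_fst differentiable_snd)

lemma Ymat_differentiable:
  assumes "x differentiable (at t)" "v differentiable (at t)" "Om differentiable (at t)"
    and "admissible D (v t)"
  shows "(\<lambda>t. Ymat D (x t) (v t) (Om t)) differentiable (at t)"
  unfolding Ymat_def case_prod_beta using assms
  by (intro differentiable_add differentiable_matrix_mul differentiable_transpose
      Bmat_differentiable hess_uu_differentiable differentiable_fst differentiable_snd)

lemma Zmat_differentiable:
  assumes "x differentiable (at t)" "v differentiable (at t)" "Om differentiable (at t)"
  shows "(\<lambda>t. Zmat D (x t) (v t) (Om t)) differentiable (at t)"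
  unfolding Zmat_def case_prod_beta using assms
  by (intro differentiable_add differentiable_matrix_mul differentiable_transpose
      Amat_differentiable hess_xx_differentiable differentiable_fst differentiable_snd)

lemma Phi_differentiable:
  assumes "x differentiable (at t)" "v differentiable (at t)" "Om differentiable (at t)"
    and "admissible D (v t)" "invertible (Ymat D (x t) (v t) (Om t))"
  shows "(\<lambda>t. Phi D (x t) (v t) (Om t)) differentiable (at t)"
  unfolding Phi_def using assms
  by (intro differentiable_matrix_mul differentiable_transpose differentiable_matrix_inv
      Xmat_differentiable Ymat_differentiable)

lemma Gmap_differentiable:
  assumes "x differentiable (at t)" "v differentiable (at t)" "Om differentiable (at t)"
    and "admissible D (v t)" "invertible (Ymat D (x t) (v t) (Om t))"
  shows "(\<lambda>t. Gmap D (x t) (v t) (Om t)) differentiable (at t)"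
  unfolding Gmap_def using assms
  by (intro differentiable_Pair differentiable_add differentiable_diff differentiable_matrix_vector_mul
      differentiable_transpose differentiable_const
      Amat_differentiable Zmat_differentiable Phi_differentiable differentiable_fst)

lemma Fmap_differentiable:
  assumes "x differentiable (at t)" "v differentiable (at t)" "S differentiable (at t)"
    and "psd (S t)"
  shows "(\<lambda>t. Fmap D (x t) (v t) (S t)) differentiable (at t)"
proof -
  have "invertible (Cmat D ** S t ** transpose (Cmat D) + Vmat D)"
    by (intro posdef_invertible psd_conj_add_posdef assms V_posdef)
  then show ?thesis
    unfolding Fmap_def using assms
    by (intro differentiable_add differentiable_diff differentiable_matrix_mul
      differentiable_transpose differentiable_matrix_inv differentiable_const Amat_differentiable)
qed

lemma psd_Fmap: "psd S \<Longrightarrow> psd (Fmap D x v S)"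
  unfolding Fmap_def by (intro psd_add psd_conj psd_conditional_variance V_posdef W_psd)

lemma hess_symmetric:
  "transpose (hess_xx (hamiltonian D lam) x v) = hess_xx (hamiltonian D lam) x v"
  "admissible D v \<Longrightarrow> transpose (hess_uu (hamiltonian D lam) x v) = hess_uu (hamiltonian D lam) x v"
proof -
  have Q: "Qmat D $ i $ j = Qmat D $ j $ i" for i j
    using arg_cong[OF Q_sym, of "\<lambda>S. S $ i $ j"] by (simp add: transpose_def)
  have R: "Rmat D $ i $ j = Rmat D $ j $ i" for i j
    using arg_cong[OF R_sym, of "\<lambda>S. S $ i $ j"] by (simp add: transpose_def)
  have "hess_xx (hamiltonian D lam) x v $ j $ i = hess_xx (hamiltonian D lam) x v $ i $ j" for i j
    unfolding hess_xx_entry Q[of j i] f2_symmetric[of lam "(x, v)" "(axis j 1, 0)"] ..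
  then show "transpose (hess_xx (hamiltonian D lam) x v) = hess_xx (hamiltonian D lam) x v"
    by (simp add: vec_eq_iff transpose_def)
  have "hess_uu (hamiltonian D lam) x v $ j $ i = hess_uu (hamiltonian D lam) x v $ i $ j"
    if "admissible D v" for i j
  proof -
    have axis: "axis j (1::real) $ i = (if i = j then 1 else 0)" for i j :: 'm
      by (simp add: axis_def)
    show ?thesis
      unfolding hess_uu_entry[OF that] R[of j i] f2_symmetric[of lam "(x, v)" "(0, axis j 1)"] axis
      by simp
  qed
  then show "transpose (hess_uu (hamiltonian D lam) x v) = hess_uu (hamiltonian D lam) x v"
    if "admissible D v"
    using that by (simp add: vec_eq_iff transpose_def)
qed

lemma Phi_symmetric:
  assumes "transpose (snd Om) = snd Om" "admissible D v" "invertible (Ymat D x v Om)"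
  shows "transpose (Phi D x v Om) = Phi D x v Om"
proof -
  have "transpose (Ymat D x v Om) = Ymat D x v Om"
    using assms(1) transpose_conj[of "snd Om" "transpose (Bmat D x v)"]
    by (simp add: Ymat_def case_prod_beta transpose_add hess_symmetric(2)[OF assms(2)])
  then show ?thesis
    by (simp add: Phi_def matrix_transpose_mul matrix_mul_assoc matrix_inv_symmetric[OF assms(3)])
qed

lemma Gmap_symmetric:
  assumes "transpose (snd Om) = snd Om" "admissible D v" "invertible (Ymat D x v Om)"
  shows "transpose (snd (Gmap D x v Om)) = snd (Gmap D x v Om)"
proof -
  have "transpose (Zmat D x v Om) = Zmat D x v Om"
    using assms(1) transpose_conj[of "snd Om" "transpose (Amat D x v)"]
    by (simp add: Zmat_def case_prod_beta transpose_add hess_symmetric(1))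
  then show ?thesis
    by (simp add: Gmap_def transpose_diff Phi_symmetric[OF assms])
qed

text \<open>
  In this lemma and the next two, the hypotheses single out points where the barrier is smooth and
  where the matrices inverted in \<open>F\<close> and in \<open>\<Phi>\<close> are invertible.
\<close>

lemma Fst_differentiable:
  assumes "psd (unvech (snd z))"
  shows "(\<lambda>(z, v). Fst D z v) differentiable (at (z, v))"
  unfolding Fst_def case_prod_beta' using assms
  by (intro differentiable_Pair dyn_differentiable differentiable_bounded_linear[OF bounded_linear_vech]
      Fmap_differentiable differentiable_bounded_linear[OF bounded_linear_unvech]
      differentiable_fst differentiable_snd differentiable_ident) simp

lemma Gst_differentiable:
  assumes "admissible D v" "invertible (Ymat D (fst z) v (unvecOm w))"
  shows "(\<lambda>(z, w, v). Gst D z w v) differentiable (at (z, w, v))"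
  unfolding Gst_def case_prod_beta' using assms
  by (intro vecOm_differentiable Gmap_differentiable unvecOm_differentiable
      differentiable_fst differentiable_snd differentiable_ident) simp_all

lemma Lst_differentiable:
  assumes "admissible D v" "invertible (Ymat D (fst z) v (unvecOm w))"
  shows "(\<lambda>(z, w, v). Lst D z w v) differentiable (at (z, w, v))"
  unfolding Lst_def case_prod_beta' using assms
  by (intro differentiable_divide differentiable_trace differentiable_matrix_mul Phi_differentiable
      unvecOm_differentiable differentiable_bounded_linear[OF bounded_linear_unvech]
      differentiable_fst differentiable_snd differentiable_ident differentiable_const) simp_all

lemma Mst_differentiable: "Mst D differentiable (at z)"
proof -
  have "(\<lambda>z. vecOm (Mmap D (fst z))) differentiable (at z)"
    unfolding Mmap_def
    by (intro vecOm_differentiable differentiable_Pair differentiable_matrix_vector_mul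
        differentiable_fst differentiable_ident differentiable_const)
  then show ?thesis by (simp add: Mst_def[abs_def])
qed

section \<open>The recursions near the given controls\<close>

lemma psd_variance: "psd S0 \<Longrightarrow> psd (variance D us x0 S0 k)"
  by (induction k) (simp_all add: psd_Fmap)

lemma unvech_stacked_state:
  assumes "psd S0"
  shows "unvech (snd (stacked_state D us x0 S0 k)) = variance D us x0 S0 k"
  using psd_variance[OF assms] by (simp add: stacked_state_def unvech_vech psd_def)

text \<open>
  The vectorized recursion follows the matrix recursion for all controls, because a positive
  semidefinite variance is symmetric, so that \<open>unvech\<close> recovers it from its independent components.
\<close>

lemma stacked_state_Suc:
  assumes "psd S0"
  shows "stacked_state D us x0 S0 (Suc k) = Fst D (stacked_state D us x0 S0 k) (us k)"
  by (simp add: Fst_def unvech_stacked_state[OF assms]) (simp add: stacked_state_def)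

lemma stacked_state_differentiable:
  fixes us :: "'a::real_normed_vector \<Rightarrow> nat \<Rightarrow> real^'m"
  assumes "psd S0" "\<And>k. (\<lambda>t. us t k) differentiable (at t)"
  shows "(\<lambda>t. stacked_state D (us t) x0 S0 k) differentiable (at t)"
proof (induction k)
  case 0
  then show ?case by (simp add: stacked_state_def)
next
  case (Suc k)
  let ?z = "\<lambda>t. (stacked_state D (us t) x0 S0 k, us t k)"
  have "(\<lambda>(z, v). Fst D z v) differentiable (at (?z t))"
    by (intro Fst_differentiable) (simp add: unvech_stacked_state psd_variance assms(1))
  from differentiable_compose[where g="?z", OF this differentiable_Pair[OF Suc assms(2)]]
  show ?case by (simp add: stacked_state_Suc[OF assms(1)])
qed

text \<open>
  Going backwards in time, differentiability and symmetry have to be proved together. If \<open>\<Omega>\<^sub>k\<^sub>+\<^sub>1\<close> is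
  differentiable at the given controls, then \<open>Y\<close> is continuous there and stays invertible nearby. If
  moreover \<open>P\<^sub>k\<^sub>+\<^sub>1\<close> is symmetric nearby, so are \<open>Y\<close> and its inverse, hence \<open>P\<^sub>k\<close>. Away
  from the given controls \<open>Y\<close> may become singular, which is why symmetry is only claimed nearby.
\<close>

lemma costate_regular_near:
  fixes us :: "'a::real_normed_vector \<Rightarrow> nat \<Rightarrow> real^'m"
  assumes us: "\<And>k. (\<lambda>t. us t k) differentiable (at t)"
    and x: "\<And>k. (\<lambda>t. state D (us t) x0 k) differentiable (at t)"
    and wd: "E_well_defined D N (us t) x0"
    and "k \<le> N"
  shows "(\<lambda>t. costate D N (us t) x0 k) differentiable (at t) \<and>
    eventually (\<lambda>s. transpose (snd (costate D N (us s) x0 k)) = snd (costate D N (us s) x0 k)) (nhds t)"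
  using \<open>k \<le> N\<close>
proof (induction k rule: inc_induct)
  case base
  have "(\<lambda>t. Mmap D (state D (us t) x0 N)) differentiable (at t)"
    unfolding Mmap_def
    by (intro differentiable_Pair differentiable_matrix_vector_mul x differentiable_const)
  then show ?case
    by (simp add: costate_N) (simp add: Mmap_def PN_sym)
next
  case (step k)
  let ?Om = "\<lambda>t. costate D N (us t) x0 (Suc k)"
  have adm: "admissible D (us t k)" and inv: "invertible (Ymat D (state D (us t) x0 k) (us t k) (?Om t))"
    using wd step.hyps by (auto simp: E_well_defined_def)
  have Om: "?Om differentiable (at t)" using step.IH by simp
  have "(\<lambda>t. Gmap D (state D (us t) x0 k) (us t k) (?Om t)) differentiable (at t)"
    by (intro Gmap_differentiable x us Om adm inv)
  moreover have "eventually (\<lambda>s. transpose (snd (Gmap D (state D (us s) x0 k) (us s k) (?Om s)))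
       = snd (Gmap D (state D (us s) x0 k) (us s k) (?Om s))) (nhds t)"
    using conjunct2[OF step.IH] eventually_admissible[OF us adm]
      eventually_invertible[OF Ymat_differentiable[OF x us Om adm] inv]
    by eventually_elim (rule Gmap_symmetric)
  ultimately show ?case
    using step.hyps by (simp add: costate_step)
qed

end

section \<open>The gradient of E\<close>

theorem theorem1:
  fixes D :: "('n::finite, 'm::finite, 'e::finite) ocp"
    and N :: nat
    and stage :: "nat \<Rightarrow> 'h::finite"
    and u \<sigma> :: "(real^'m)^'h"
    and y :: "real^'n"
    and \<Sigma>0 :: "real^'n^'n"
    and \<kappa> \<omega> a b :: "nat \<Rightarrow> 'n stacked"
  assumes f_C3: "C3 (\<lambda>(x, v). dyn D x v)"
    and f_0: "dyn D 0 0 = 0"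
    and bounds: "\<And>i. u_lo D $ i < 0 \<and> 0 < u_hi D $ i"
    and Q: "psd (Qmat D)"
    and PN: "psd (PNmat D)"
    and R: "psd (Rmat D)"
    and tau: "barrier D > 0"
    and W: "psd (Wmat D)"
    and V: "posdef (Vmat D)"
    \<comment> \<open>the blocks of \<open>u\<close> and \<open>\<sigma>\<close> are numbered \<open>0, \<dots>, N - 1\<close>\<close>
    and stage: "bij_betw stage {..<N} UNIV"
    and S0: "psd \<Sigma>0"
    and wd: "E_well_defined D N (\<lambda>k. u $ stage k) y"
    and kappa_0: "\<kappa> 0 = (y, vech \<Sigma>0)"
    and kappa_step: "\<And>k. k < N \<Longrightarrow> \<kappa> (Suc k) = Fst D (\<kappa> k) (u $ stage k)"
    and omega_N: "\<omega> N = Mst D (\<kappa> N)"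
    and omega_step: "\<And>k. k < N \<Longrightarrow> \<omega> k = Gst D (\<kappa> k) (\<omega> (Suc k)) (u $ stage k)"
    and a_0: "a 0 = 0"
    and a_step: "\<And>k. k < N \<Longrightarrow>
      a (Suc k) = nabla (\<lambda>w. Gst D (\<kappa> k) w (u $ stage k)) (\<omega> (Suc k)) (a k)
                - grad (\<lambda>w. Lst D (\<kappa> k) w (u $ stage k)) (\<omega> (Suc k))"
    and b_N: "b N = nabla (Mst D) (\<kappa> N) (a N)"
    and b_step: "\<And>k. k < N \<Longrightarrow>
      b k = nabla (\<lambda>z. Gst D z (\<omega> (Suc k)) (u $ stage k)) (\<kappa> k) (a k)
          + nabla (\<lambda>z. Fst D z (u $ stage k)) (\<kappa> k) (b (Suc k))
          - grad (\<lambda>z. Lst D z (\<omega> (Suc k)) (u $ stage k)) (\<kappa> k)"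
    and sigma: "\<And>k. k < N \<Longrightarrow>
      \<sigma> $ stage k = grad (\<lambda>v. Lst D (\<kappa> k) (\<omega> (Suc k)) v) (u $ stage k)
                  - nabla (\<lambda>v. Gst D (\<kappa> k) (\<omega> (Suc k)) v) (u $ stage k) (a k)
                  - nabla (\<lambda>v. Fst D (\<kappa> k) v) (u $ stage k) (b (Suc k))"
  shows "GDERIV (\<lambda>u'. Efun D N (\<lambda>k. u' $ stage k) y \<Sigma>0) u :> \<sigma>"
proof -
  obtain f1 f2 f3 where f1: "\<And>z. ((\<lambda>(x, v). dyn D x v) has_derivative blinfun_apply (f1 z)) (at z)"
    and f2: "\<And>z. (f1 has_derivative blinfun_apply (f2 z)) (at z)"
    and f3: "\<And>z. (f2 has_derivative blinfun_apply (f3 z)) (at z)"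
    using f_C3 unfolding C3_def by blast
  interpret smooth_ocp D f1 f2
    using Q R PN W V by unfold_locales (auto simp only: psd_def intro!: f1 f2 differentiableI[OF f3])

  \<comment> \<open>the nominal sweeps as functions of the controls\<close>
  define us :: "(real^'m)^'h \<Rightarrow> nat \<Rightarrow> real^'m" where "us u' = (\<lambda>k. u' $ stage k)" for u'
  define kap where "kap u' = stacked_state D (us u') y \<Sigma>0" for u'
  define Om where "Om u' = costate D N (us u') y" for u'
  define om where "om u' k = vecOm (Om u' k)" for u' k

  have us_diff: "(\<lambda>u'. us u' k) differentiable (at u)" for k
    unfolding us_def by (intro differentiable_vec_nth differentiable_ident)
  have kap_diff: "(\<lambda>u'. kap u' k) differentiable (at u)" for k
    unfolding kap_def by (rule stacked_state_differentiable[OF S0 us_diff])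
  have state_diff: "(\<lambda>u'. state D (us u') y k) differentiable (at u)" for k
    using differentiable_fst[OF kap_diff[of k]] by (simp add: kap_def stacked_state_def)
  have wd': "E_well_defined D N (us u) y"
    using wd by (simp add: us_def)
  have Om_diff: "(\<lambda>u'. Om u' k) differentiable (at u)"
    and Om_sym: "eventually (\<lambda>u'. transpose (snd (Om u' k)) = snd (Om u' k)) (nhds u)"
    if "k \<le> N" for k
    using costate_regular_near[OF us_diff state_diff wd' that] by (auto simp: Om_def)
  have om_unvec: "eventually (\<lambda>u'. unvecOm (om u' k) = Om u' k) (nhds u)" if "k \<le> N" for k
    using Om_sym[OF that] by eventually_elim (simp add: om_def unvecOm_vecOm)

  have kap_Suc: "kap u' (Suc k) = Fst D (kap u' k) (u' $ stage k)" for u' k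
    by (simp add: kap_def stacked_state_Suc[OF S0] us_def)
  have unvech_kap: "unvech (snd (kap u' k)) = variance D (us u') y \<Sigma>0 k" for u' k
    by (simp add: kap_def unvech_stacked_state[OF S0])
  have fst_kap: "fst (kap u' k) = state D (us u') y k" for u' k
    by (simp add: kap_def stacked_state_def)
  have om_N: "om u' N = Mst D (kap u' N)" for u'
    by (simp add: om_def Om_def costate_N Mst_def fst_kap)
  have om_Gst: "eventually (\<lambda>u'. om u' k = Gst D (kap u' k) (om u' (Suc k)) (u' $ stage k)) (nhds u)"
    if k: "k < N" for k
    using om_unvec[OF Suc_leI[OF k]]
    by eventually_elim (simp add: om_def[of _ k] Om_def costate_step[OF k] Gst_def fst_kap us_def)

  \<comment> \<open>at \<open>u\<close> itself, these are the sweeps of the algorithm\<close>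
  have \<kappa>_eq: "\<kappa> k = kap u k" if "k \<le> N" for k
    using that
  proof (induction k)
    case 0
    then show ?case by (simp add: kappa_0 kap_def stacked_state_def)
  next
    case (Suc k)
    then show ?case by (simp add: kappa_step kap_Suc)
  qed
  have \<omega>_eq: "\<omega> k = om u k" if "k \<le> N" for k
    using that
  proof (induction k rule: inc_induct)
    case base
    then show ?case by (simp add: omega_N om_N \<kappa>_eq)
  next
    case (step k)
    then show ?case
      using eventually_nhds_x_imp_x[OF om_Gst[of k]] by (simp add: omega_step \<kappa>_eq)
  qed

  have regular: "admissible D (u $ stage k)"
      "invertible (Ymat D (fst (kap u k)) (u $ stage k) (unvecOm (om u (Suc k))))"
    if k: "k < N" for k
    using wd' k eventually_nhds_x_imp_x[OF om_unvec[OF Suc_leI[OF k]]]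
    by (auto simp: E_well_defined_def fst_kap Om_def us_def)

  show ?thesis
  proof (rule adjoint_sweep_gradient[where F="Fst D" and G="Gst D" and L="Lst D" and M="Mst D"
        and kap=kap and om=om and a=a and b=b and N=N and stage=stage and start="(y, vech \<Sigma>0)"])
    show "(\<lambda>(z, v). Fst D z v) differentiable (at (kap u k, u $ stage k))" for k
      by (intro Fst_differentiable) (simp add: unvech_kap psd_variance[OF S0])
    show "(\<lambda>(z, w, v). Gst D z w v) differentiable (at (kap u k, om u (Suc k), u $ stage k))"
      if "k < N" for k
      by (intro Gst_differentiable regular[OF that])
    show "(\<lambda>(z, w, v). Lst D z w v) differentiable (at (kap u k, om u (Suc k), u $ stage k))"
      if "k < N" for k
      by (intro Lst_differentiable regular[OF that])
    show "(\<lambda>u'. om u' k) differentiable (at u)" if "k \<le> N" for k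
      unfolding om_def by (intro vecOm_differentiable Om_diff that)
    show "kap u' 0 = (y, vech \<Sigma>0)" for u'
      by (simp add: kap_def stacked_state_def)
    have "eventually (\<lambda>u'. \<forall>k\<in>{..<N}. unvecOm (om u' (Suc k)) = Om u' (Suc k)) (nhds u)"
      by (intro eventually_ball_finite ballI om_unvec) auto
    then show "eventually (\<lambda>u'. Efun D N (\<lambda>k. u' $ stage k) y \<Sigma>0
        = (\<Sum>k<N. Lst D (kap u' k) (om u' (Suc k)) (u' $ stage k))) (nhds u)"
      by eventually_elim
        (simp add: Efun_def Lst_def fst_kap unvech_kap flip: us_def, simp add: Om_def us_def)
    show "a (Suc k) = nabla (\<lambda>w. Gst D (kap u k) w (u $ stage k)) (om u (Suc k)) (a k)
        - grad (\<lambda>w. Lst D (kap u k) w (u $ stage k)) (om u (Suc k))" if "k < N" for k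
      using a_step[OF that] that by (simp add: \<kappa>_eq \<omega>_eq)
    show "b N = nabla (Mst D) (kap u N) (a N)"
      using b_N by (simp add: \<kappa>_eq)
    show "b k = nabla (\<lambda>z. Gst D z (om u (Suc k)) (u $ stage k)) (kap u k) (a k)
        + nabla (\<lambda>z. Fst D z (u $ stage k)) (kap u k) (b (Suc k))
        - grad (\<lambda>z. Lst D z (om u (Suc k)) (u $ stage k)) (kap u k)" if "k < N" for k
      using b_step[OF that] that by (simp add: \<kappa>_eq \<omega>_eq)
    show "\<sigma> $ stage k = grad (\<lambda>v. Lst D (kap u k) (om u (Suc k)) v) (u $ stage k)
        - nabla (\<lambda>v. Gst D (kap u k) (om u (Suc k)) v) (u $ stage k) (a k)
        - nabla (\<lambda>v. Fst D (kap u k) v) (u $ stage k) (b (Suc k))" if "k < N" for k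
      using sigma[OF that] that by (simp add: \<kappa>_eq \<omega>_eq)
  qed (simp_all add: stage a_0 kap_diff kap_Suc om_N om_Gst Mst_differentiable)
qed

end
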